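(* Let $m\ge p$, let $Y\in\mathbb{C}^{m\times p}$ have orthonormal columns, and let $H\in T_YGr(p,m)$. Then, for any integer $n\ge0$, $$\mathrm{dist}^{Gr}\left(\mathcal{Q}\left(Y\alpha_n(t^2H^*H)+tH\beta_n(t^2H^*H)\right),\ \mathrm{Exp}^{Gr}_Y(tH)\right)=O(t^{2n+1}),$$ where $$\alpha_n(z)=\sum_{j=0}^{\lfloor n/2\rfloor}a_{2j}(-z)^j,\qquad \beta_n(z)=\sum_{j=0}^{\lfloor (n-1)/2\rfloor}a_{2j+1}(-z)^j,\qquad a_k=\binom{n}{k}\frac{(2n-k)!}{(2n)!}2^k,\quad k=0,1,\dots,n.$$
   Context: $Gr(p,m)$ is the Grassmannian manifold of $p$-dimensional subspaces of $\mathbb{C}^m$; a subspace is represented by a matrix $Y\in\mathbb{C}^{m\times p}$ with orthonormal columns spanning it. With this representation, $T_YGr(p,m)=\{Y_\perp K\mid K\in\mathbb{C}^{(m-p)\times p}\}$, where $Y_\perp\in\mathbb{C}^{m\times(m-p)}$ is any matrix such that $\begin{pmatrix}Y&Y_\perp\end{pmatrix}$ is unitary. For $H=Y_\perp K$, the Riemannian exponential (with respect to the canonical metric) is represented by $$\mathrm{Exp}^{Gr}_Y H=\begin{pmatrix}Y&Y_\perp\end{pmatrix}\exp\begin{pmatrix}0&-K^* \\ K&0\end{pmatrix}\begin{pmatrix}I \\ 0\end{pmatrix}.$$ For a full-rank $A\in\mathbb{C}^{m\times p}$ ($m\ge p$), $\mathcal{Q}(A)=Q$ denotes the factor in the QR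 decomposition $A=QR$, where $Q\in\mathbb{C}^{m\times p}$ has orthonormal columns and $R\in\mathbb{C}^{p\times p}$ is upper triangular. For $X,Y\in\mathbb{C}^{m\times p}$ with orthonormal columns, $$\mathrm{dist}^{Gr}(X,Y)=\min_{V,W\in\mathbb{C}^{p\times p},\ V^*V=W^*W=I}\|XV-YW\|,$$ with $\|\cdot\|$ the Frobenius norm. Here $t$ is a real scalar, $O(\cdot)$ is as $t\to0$ with implied constant depending on the other data, and for $t$ sufficiently small the argument of $\mathcal{Q}$ has full rank. Empty sums are zero. *)

theory Defs
  imports
    "Jordan_Normal_Form.DL_Rank"
    "Jordan_Normal_Form.Schur_Decomposition"
    "HOL-Library.Landau_Symbols"
    "HOL-Analysis.Function_Topology"
begin

text \<open>Matrices are those of \<^term>\<open>Matrix.mat\<close> with explicit dimensions, so that the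
  \<open>m \<times> (m - p)\<close> blocks below make sense also for \<open>p = m\<close>.  The conjugate transpose is
  \<^const>\<open>mat_adjoint\<close>.\<close>

definition orthonormal_cols :: "complex mat \<Rightarrow> bool" where
  "orthonormal_cols A \<longleftrightarrow> mat_adjoint A * A = 1\<^sub>m (dim_col A)"

definition unitary_mat :: "complex mat \<Rightarrow> bool" where
  "unitary_mat U \<longleftrightarrow> square_mat U \<and> mat_adjoint U * U = 1\<^sub>m (dim_col U)"

definition frobenius_norm :: "complex mat \<Rightarrow> real" where
  "frobenius_norm A = sqrt (\<Sum>i<dim_row A. \<Sum>j<dim_col A. (cmod (A $$ (i, j)))\<^sup>2)"

definition append_cols :: "complex mat \<Rightarrow> complex mat \<Rightarrow> complex mat" where
  "append_cols A B = four_block_mat A B (0\<^sub>m 0 (dim_col A)) (0\<^sub>m 0 (dim_col B))"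

definition mat_exp :: "complex mat \<Rightarrow> complex mat" where
  "mat_exp A = mat (dim_row A) (dim_col A) (\<lambda>(i, j). \<Sum>k. (A ^\<^sub>m k) $$ (i, j) / fact k)"

text \<open>No sign normalisation of the diagonal of \<open>R\<close> is imposed, so \<open>Q\<close> is determined by a
  full-rank \<open>A\<close> only up to unit scalars on its columns.  For existence see
  \<open>qr_decomposition_exists\<close> below.\<close>

definition qr_decomposition :: "complex mat \<Rightarrow> complex mat \<Rightarrow> complex mat \<Rightarrow> bool" where
  "qr_decomposition A Q R \<longleftrightarrow>
     Q \<in> carrier_mat (dim_row A) (dim_col A) \<and> R \<in> carrier_mat (dim_col A) (dim_col A) \<and>
     orthonormal_cols Q \<and> upper_triangular R \<and> A = Q * R"

definition orth_complements :: "complex mat \<Rightarrow> complex mat set" where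
  "orth_complements Y =
     {Y' \<in> carrier_mat (dim_row Y) (dim_row Y - dim_col Y). unitary_mat (append_cols Y Y')}"

definition grassmann_tangent :: "complex mat \<Rightarrow> complex mat set" where
  "grassmann_tangent Y =
     {Y' * K | Y' K. Y' \<in> orth_complements Y \<and> K \<in> carrier_mat (dim_row Y - dim_col Y) (dim_col Y)}"

definition grassmann_exp_rep :: "complex mat \<Rightarrow> complex mat \<Rightarrow> complex mat \<Rightarrow> complex mat" where
  "grassmann_exp_rep Y Y' K =
     (let p = dim_col Y; q = dim_row Y - dim_col Y in
      append_cols Y Y' * mat_exp (four_block_mat (0\<^sub>m p p) (- mat_adjoint K) K (0\<^sub>m q q))
        * (1\<^sub>m p @\<^sub>r 0\<^sub>m q p))"

text \<open>For tangent \<open>H\<close> the representative does not depend on the decomposition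
  \<open>H = Y' * K\<close>; see \<open>grassmann_exp_eq\<close> below.\<close>

definition grassmann_exp :: "complex mat \<Rightarrow> complex mat \<Rightarrow> complex mat" where
  "grassmann_exp Y H =
     (THE E. \<exists>Y' K. Y' \<in> orth_complements Y \<and>
        K \<in> carrier_mat (dim_row Y - dim_col Y) (dim_col Y) \<and>
        H = Y' * K \<and> E = grassmann_exp_rep Y Y' K)"

text \<open>The infimum is a minimum; see \<open>grassmann_dist_attained\<close> below.\<close>

definition grassmann_dist :: "complex mat \<Rightarrow> complex mat \<Rightarrow> real" where
  "grassmann_dist X Y =
     Inf {frobenius_norm (X * V - Y * W) | V W.
            V \<in> carrier_mat (dim_col X) (dim_col X) \<and> unitary_mat V \<and>
            W \<in> carrier_mat (dim_col Y) (dim_col Y) \<and> unitary_mat W}"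

definition pade_coeff :: "nat \<Rightarrow> nat \<Rightarrow> real" where
  "pade_coeff n k = real (n choose k) * (fact (2 * n - k) / fact (2 * n)) * 2 ^ k"

text \<open>\<open>\<alpha>\<^sub>n(Z)\<close> and \<open>\<beta>\<^sub>n(Z)\<close> for a square matrix \<open>Z\<close>, with the sums written entrywise.
  In \<open>\<beta>\<^sub>n\<close> the range \<open>0 \<le> j \<le> \<lfloor>(n - 1) / 2\<rfloor>\<close> is \<open>j < (n + 1) div 2\<close>, which is empty for
  \<open>n = 0\<close>.\<close>

definition pade_alpha :: "nat \<Rightarrow> complex mat \<Rightarrow> complex mat" where
  "pade_alpha n Z = mat (dim_row Z) (dim_col Z)
     (\<lambda>(r, c). \<Sum>j\<le>n div 2. complex_of_real (pade_coeff n (2 * j)) * ((- Z) ^\<^sub>m j) $$ (r, c))"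

definition pade_beta :: "nat \<Rightarrow> complex mat \<Rightarrow> complex mat" where
  "pade_beta n Z = mat (dim_row Z) (dim_col Z)
     (\<lambda>(r, c). \<Sum>j<(n + 1) div 2. complex_of_real (pade_coeff n (2 * j + 1)) * ((- Z) ^\<^sub>m j) $$ (r, c))"

lemma mat_adjoint_dim [simp]:
  "dim_row (mat_adjoint A) = dim_col A" "dim_col (mat_adjoint A) = dim_row A"
  by (auto simp: mat_adjoint_def)

lemma mat_adjoint_carrier [simp]:
  "A \<in> carrier_mat r c \<Longrightarrow> mat_adjoint A \<in> carrier_mat c r"
  by auto

lemma mat_adjoint_index [simp]:
  "i < dim_col A \<Longrightarrow> j < dim_row A \<Longrightarrow> mat_adjoint A $$ (i, j) = conjugate (A $$ (j, i))"
  by (simp add: mat_adjoint_def mat_of_rows_index)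

lemma mat_adjoint_mult:
  assumes "(A :: complex mat) \<in> carrier_mat r k" "B \<in> carrier_mat k c"
  shows "mat_adjoint (A * B) = mat_adjoint B * mat_adjoint A"
  using assms
  by (intro eq_matI) (auto simp: scalar_prod_def mult.commute intro!: sum.cong)

lemma mat_adjoint_adjoint: "mat_adjoint (mat_adjoint A) = (A :: complex mat)"
  by (intro eq_matI) auto

lemma mat_adjoint_append_cols:
  assumes "A \<in> carrier_mat r p" "B \<in> carrier_mat r q"
  shows "mat_adjoint (append_cols A B) = four_block_mat (mat_adjoint A) (0\<^sub>m p 0) (mat_adjoint B) (0\<^sub>m q 0)"
  using assms by (intro eq_matI) (auto simp: append_cols_def)

lemma append_cols_carrier [simp]:
  assumes "A \<in> carrier_mat r p" "B \<in> carrier_mat r q"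
  shows "append_cols A B \<in> carrier_mat r (p + q)"
  using assms by (auto simp: append_cols_def)

lemma append_cols_mult_four_block:
  assumes "A \<in> carrier_mat r p" "B \<in> carrier_mat r q"
    "A1 \<in> carrier_mat p a" "B1 \<in> carrier_mat p b" "C1 \<in> carrier_mat q a" "D1 \<in> carrier_mat q b"
  shows "append_cols A B * four_block_mat A1 B1 C1 D1
       = append_cols (A * A1 + B * C1) (A * B1 + B * D1)"
  unfolding append_cols_def using assms
  by (subst mult_four_block_mat[of _ r p _ q _ 0 _ _ a _ b]) (auto intro!: cong_four_block_mat)

lemma adjoint_append_cols_mult:
  assumes A: "A \<in> carrier_mat r p" and B: "B \<in> carrier_mat r q"
  shows "mat_adjoint (append_cols A B) * append_cols A B
       = four_block_mat (mat_adjoint A * A) (mat_adjoint A * B) (mat_adjoint B * A) (mat_adjoint B * B)"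
  unfolding mat_adjoint_append_cols[OF A B] unfolding append_cols_def using A B
  by (subst mult_four_block_mat[of _ p r _ 0 _ q _ _ p _ q]) (auto intro!: cong_four_block_mat)

lemma append_cols_mult_adjoint:
  assumes A: "A \<in> carrier_mat r p" and B: "B \<in> carrier_mat r q"
  shows "append_cols A B * mat_adjoint (append_cols A B) = A * mat_adjoint A + B * mat_adjoint B"
proof -
  have "append_cols A B * mat_adjoint (append_cols A B)
      = four_block_mat (A * mat_adjoint A + B * mat_adjoint B) (0\<^sub>m r 0) (0\<^sub>m 0 r) (0\<^sub>m 0 0)"
    unfolding mat_adjoint_append_cols[OF A B] unfolding append_cols_def using A B
    by (subst mult_four_block_mat[of _ r p _ q _ 0 _ _ r _ 0]) (auto intro!: cong_four_block_mat)
  also have "\<dots> = A * mat_adjoint A + B * mat_adjoint B"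
    using A B by (intro eq_matI) auto
  finally show ?thesis .
qed

lemma four_block_eq_iff:
  assumes "A \<in> carrier_mat a c" "B \<in> carrier_mat a d" "C \<in> carrier_mat b c" "D \<in> carrier_mat b d"
    "A' \<in> carrier_mat a c" "B' \<in> carrier_mat a d" "C' \<in> carrier_mat b c" "D' \<in> carrier_mat b d"
  shows "four_block_mat A B C D = four_block_mat A' B' C' D' \<longleftrightarrow> A = A' \<and> B = B' \<and> C = C' \<and> D = D'"
proof
  assume eq: "four_block_mat A B C D = four_block_mat A' B' C' D'"
  have e: "four_block_mat A B C D $$ (i,j) = four_block_mat A' B' C' D' $$ (i,j)" for i j using eq by simp
  have "A $$ (i,j) = A' $$ (i,j)" if "i < a" "j < c" for i j
    using e[of i j] that assms by auto
  moreover have "B $$ (i,j) = B' $$ (i,j)" if "i < a" "j < d" for i j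
    using e[of i "j + c"] that assms by auto
  moreover have "C $$ (i,j) = C' $$ (i,j)" if "i < b" "j < c" for i j
    using e[of "i+a" j] that assms by auto
  moreover have "D $$ (i,j) = D' $$ (i,j)" if "i < b" "j < d" for i j
    using e[of "i+a" "j+c"] that assms by auto
  ultimately show "A = A' \<and> B = B' \<and> C = C' \<and> D = D'" using assms by (auto intro!: eq_matI)
qed auto

lemma orth_complementsD:
  assumes Y: "Y \<in> carrier_mat m p" and Y': "Y' \<in> orth_complements Y"
  shows "p \<le> m" "Y' \<in> carrier_mat m (m - p)"
    "mat_adjoint Y * Y = 1\<^sub>m p" "mat_adjoint Y * Y' = 0\<^sub>m p (m - p)"
    "mat_adjoint Y' * Y = 0\<^sub>m (m - p) p" "mat_adjoint Y' * Y' = 1\<^sub>m (m - p)"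
    "Y * mat_adjoint Y + Y' * mat_adjoint Y' = 1\<^sub>m m"
proof -
  show c: "Y' \<in> carrier_mat m (m - p)" using assms by (auto simp: orth_complements_def)
  have u: "unitary_mat (append_cols Y Y')" using Y' by (auto simp: orth_complements_def)
  have ac: "append_cols Y Y' \<in> carrier_mat m (p + (m - p))" using Y c by simp
  have "m = p + (m - p)" using u ac by (auto simp: unitary_mat_def)
  thus pm: "p \<le> m" by simp
  have sq: "append_cols Y Y' \<in> carrier_mat m m" using ac pm by simp
  have U: "mat_adjoint (append_cols Y Y') * append_cols Y Y' = 1\<^sub>m m"
    using u sq by (auto simp: unitary_mat_def)
  have "four_block_mat (mat_adjoint Y * Y) (mat_adjoint Y * Y') (mat_adjoint Y' * Y) (mat_adjoint Y' * Y')
    = four_block_mat (1\<^sub>m p) (0\<^sub>m p (m-p)) (0\<^sub>m (m-p) p) (1\<^sub>m (m-p))"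
    using U pm unfolding adjoint_append_cols_mult[OF Y c] four_block_one_mat by simp
  hence "mat_adjoint Y * Y = 1\<^sub>m p \<and> mat_adjoint Y * Y' = 0\<^sub>m p (m - p) \<and>
    mat_adjoint Y' * Y = 0\<^sub>m (m - p) p \<and> mat_adjoint Y' * Y' = 1\<^sub>m (m - p)"
    by (subst (asm) four_block_eq_iff[of _ p p _ "m-p" _ "m-p"]) (use Y c in auto)
  thus "mat_adjoint Y * Y = 1\<^sub>m p" "mat_adjoint Y * Y' = 0\<^sub>m p (m - p)"
    "mat_adjoint Y' * Y = 0\<^sub>m (m - p) p" "mat_adjoint Y' * Y' = 1\<^sub>m (m - p)" by auto
  have "append_cols Y Y' * mat_adjoint (append_cols Y Y') = 1\<^sub>m m"
    using mat_mult_left_right_inverse[OF _ sq U] sq by simp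
  thus "Y * mat_adjoint Y + Y' * mat_adjoint Y' = 1\<^sub>m m"
    unfolding append_cols_mult_adjoint[OF Y c] .
qed

text \<open>The series defining \<^const>\<open>mat_exp\<close> converges absolutely.\<close>

lemma pow_mat_entry_bound:
  assumes A: "(A :: complex mat) \<in> carrier_mat n n" and "i < n" "j < n"
  shows "norm ((A ^\<^sub>m k) $$ (i, j)) \<le> (\<Sum>r<n. \<Sum>c<n. norm (A $$ (r, c))) ^ k"
  using \<open>j < n\<close>
proof (induction k arbitrary: j)
  case 0
  thus ?case using assms by auto
next
  case (Suc k)
  let ?c = "\<Sum>r<n. \<Sum>c<n. norm (A $$ (r, c))"
  have nn: "0 \<le> ?c" by (intro sum_nonneg) auto
  have "(A ^\<^sub>m Suc k) $$ (i, j) = (\<Sum>l<n. (A ^\<^sub>m k) $$ (i, l) * A $$ (l, j))"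
    using A \<open>i < n\<close> Suc.prems by (auto simp: scalar_prod_def atLeast0LessThan pow_mat_dim_square[OF A])
  hence "norm ((A ^\<^sub>m Suc k) $$ (i, j)) \<le> (\<Sum>l<n. norm ((A ^\<^sub>m k) $$ (i, l)) * norm (A $$ (l, j)))"
    by (simp add: norm_mult[symmetric] sum_norm_le)
  also have "\<dots> \<le> (\<Sum>l<n. ?c ^ k * norm (A $$ (l, j)))"
    by (intro sum_mono mult_right_mono Suc.IH) auto
  also have "\<dots> = ?c ^ k * (\<Sum>l<n. norm (A $$ (l, j)))" by (simp add: sum_distrib_left)
  also have "\<dots> \<le> ?c ^ k * ?c"
    using Suc.prems nn by (intro mult_left_mono sum_mono member_le_sum) auto
  finally show ?case by (simp add: mult.commute)
qed

lemma mat_exp_summable: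
  assumes A: "(A :: complex mat) \<in> carrier_mat n n" and "i < n" "j < n"
  shows "summable (\<lambda>k. (A ^\<^sub>m k) $$ (i, j) / fact k)"
proof (rule summable_comparison_test')
  let ?c = "\<Sum>r<n. \<Sum>c<n. norm (A $$ (r, c))"
  show "summable (\<lambda>k. ?c ^ k / fact k)"
    using summable_exp[of ?c] by (simp add: field_simps)
  show "norm ((A ^\<^sub>m k) $$ (i, j) / fact k) \<le> ?c ^ k / fact k" for k
    using pow_mat_entry_bound[OF assms, of k] by (simp add: norm_divide divide_right_mono)
qed

lemma mat_exp_carrier [simp]: "A \<in> carrier_mat n n \<Longrightarrow> mat_exp A \<in> carrier_mat n n"
  by (simp add: mat_exp_def)

lemma mat_exp_intertwine:
  assumes A: "A \<in> carrier_mat n n" and B: "B \<in> carrier_mat n n" and D: "D \<in> carrier_mat n n"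
    and com: "D * B = A * D"
  shows "D * mat_exp B = mat_exp A * D"
proof -
  have pw: "D * (B ^\<^sub>m k) = (A ^\<^sub>m k) * D" for k
  proof (induction k)
    case (Suc k)
    have Bk: "B ^\<^sub>m k \<in> carrier_mat n n" and Ak: "A ^\<^sub>m k \<in> carrier_mat n n"
      using A B by (simp_all add: pow_carrier_mat)
    have "D * (B ^\<^sub>m Suc k) = (D * B ^\<^sub>m k) * B" using Bk B D by (simp add: assoc_mult_mat[of _ n n _ n _ n])
    also have "\<dots> = A ^\<^sub>m k * (D * B)" unfolding Suc using Ak B D by (simp add: assoc_mult_mat[of _ n n _ n _ n])
    also have "\<dots> = (A ^\<^sub>m Suc k) * D" unfolding com using Ak A D by (simp add: assoc_mult_mat[of _ n n _ n _ n])
    finally show ?case .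
  qed (use A B D in auto)
  show ?thesis
  proof (rule eq_matI)
    fix i j assume ij': "i < dim_row (mat_exp A * D)" "j < dim_col (mat_exp A * D)"
    hence ij: "i < n" "j < n" using A D by (auto simp: mat_exp_def)
    have "(D * mat_exp B) $$ (i, j) = (\<Sum>l<n. D $$ (i, l) * (\<Sum>k. (B ^\<^sub>m k) $$ (l, j) / fact k))"
      using B D ij by (auto simp: mat_exp_def scalar_prod_def atLeast0LessThan intro!: sum.cong)
    also have "\<dots> = (\<Sum>l<n. \<Sum>k. D $$ (i, l) * ((B ^\<^sub>m k) $$ (l, j) / fact k))"
      using ij by (intro sum.cong refl suminf_mult[symmetric] mat_exp_summable[OF B]) auto
    also have "\<dots> = (\<Sum>k. \<Sum>l<n. D $$ (i, l) * ((B ^\<^sub>m k) $$ (l, j) / fact k))"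
      using ij by (intro suminf_sum[symmetric] summable_mult mat_exp_summable[OF B]) auto
    also have "\<dots> = (\<Sum>k. (D * B ^\<^sub>m k) $$ (i, j) / fact k)"
      using B D ij by (intro arg_cong[of _ _ suminf] ext)
        (auto simp: scalar_prod_def atLeast0LessThan sum_divide_distrib pow_mat_dim_square[OF B])
    also have "\<dots> = (\<Sum>k. (A ^\<^sub>m k * D) $$ (i, j) / fact k)" unfolding pw ..
    also have "\<dots> = (\<Sum>k. \<Sum>l<n. (A ^\<^sub>m k) $$ (i, l) / fact k * D $$ (l, j))"
      using A D ij by (intro arg_cong[of _ _ suminf] ext)
        (auto simp: scalar_prod_def atLeast0LessThan sum_divide_distrib pow_mat_dim_square[OF A])
    also have "\<dots> = (\<Sum>l<n. \<Sum>k. (A ^\<^sub>m k) $$ (i, l) / fact k * D $$ (l, j))"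
      using ij by (intro suminf_sum summable_mult2 mat_exp_summable[OF A]) auto
    also have "\<dots> = (\<Sum>l<n. (\<Sum>k. (A ^\<^sub>m k) $$ (i, l) / fact k) * D $$ (l, j))"
      using ij by (intro sum.cong refl suminf_mult2[symmetric] mat_exp_summable[OF A]) auto
    also have "\<dots> = (mat_exp A * D) $$ (i, j)"
      using A D ij by (auto simp: mat_exp_def scalar_prod_def atLeast0LessThan intro!: sum.cong)
    finally show "(D * mat_exp B) $$ (i, j) = (mat_exp A * D) $$ (i, j)" .
  qed (use A B D in \<open>auto simp: mat_exp_def\<close>)
qed

lemma grassmann_exp_rep_unique:
  assumes Y: "Y \<in> carrier_mat m p"
    and Y1: "Y1 \<in> orth_complements Y" and K1: "K1 \<in> carrier_mat (m - p) p"
    and Y2: "Y2 \<in> orth_complements Y" and K2: "K2 \<in> carrier_mat (m - p) p"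
    and eq: "Y1 * K1 = Y2 * K2"
  shows "grassmann_exp_rep Y Y1 K1 = grassmann_exp_rep Y Y2 K2"
proof -
  define q where "q = m - p"
  note c1 = orth_complementsD[OF Y Y1, folded q_def] and c2 = orth_complementsD[OF Y Y2, folded q_def]
  note K1 = K1[folded q_def] and K2 = K2[folded q_def]
  have m: "m = p + q" using c1(1) by (simp add: q_def)
  note Y1c = c1(2) and Y2c = c2(2)
  define U where "U = mat_adjoint Y1 * Y2"
  have U: "U \<in> carrier_mat q q" unfolding U_def using Y1c Y2c by auto
  have one_Y1: "Y1 * U = Y2"
  proof -
    have "Y2 = (Y * mat_adjoint Y + Y1 * mat_adjoint Y1) * Y2" using c1(7) Y2c by simp
    also have "\<dots> = Y * (mat_adjoint Y * Y2) + Y1 * (mat_adjoint Y1 * Y2)"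
      using Y Y1c Y2c by (simp add: add_mult_distrib_mat[of _ m m _ _ q] assoc_mult_mat[of _ m _ _ m _ q])
    also have "\<dots> = Y1 * U" unfolding c2(4) U_def[symmetric]
      using Y mult_carrier_mat[OF Y1c U] by simp
    finally show ?thesis by simp
  qed
  have UK2: "U * K2 = K1"
  proof -
    have "U * K2 = mat_adjoint Y1 * (Y1 * K1)" unfolding eq U_def
      using Y1c Y2c K2 by (simp add: assoc_mult_mat[of _ q m _ q _ p])
    also have "\<dots> = K1" using Y1c K1 c1(6)
      by (simp add: assoc_mult_mat[of _ q m _ q _ p, symmetric])
    finally show ?thesis .
  qed
  have UU: "mat_adjoint U * U = 1\<^sub>m q"
  proof -
    have "mat_adjoint U = mat_adjoint Y2 * Y1"
      unfolding U_def using Y1c Y2c by (simp add: mat_adjoint_mult[of _ q m] mat_adjoint_adjoint)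
    hence "mat_adjoint U * U = mat_adjoint Y2 * (Y1 * U)"
      using U Y1c Y2c by (simp add: assoc_mult_mat[of _ q m _ q _ q])
    thus ?thesis unfolding one_Y1 c2(6) .
  qed
  hence UU': "U * mat_adjoint U = 1\<^sub>m q"
    using mat_mult_left_right_inverse[of "mat_adjoint U" q U] U by simp
  have K1U: "mat_adjoint K1 * U = mat_adjoint K2"
  proof -
    have "mat_adjoint K1 = mat_adjoint K2 * mat_adjoint U"
      unfolding UK2[symmetric] using U K2 by (simp add: mat_adjoint_mult[of _ q q])
    thus ?thesis using U K2 UU by (simp add: assoc_mult_mat[of _ p q _ q _ q])
  qed
  define D where "D = four_block_mat (1\<^sub>m p) (0\<^sub>m p q) (0\<^sub>m q p) U"
  define B1 where "B1 = four_block_mat (0\<^sub>m p p) (- mat_adjoint K1) K1 (0\<^sub>m q q)"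
  define B2 where "B2 = four_block_mat (0\<^sub>m p p) (- mat_adjoint K2) K2 (0\<^sub>m q q)"
  have D: "D \<in> carrier_mat m m" and B1: "B1 \<in> carrier_mat m m" and B2: "B2 \<in> carrier_mat m m"
    unfolding D_def B1_def B2_def m using U K1 K2 by auto
  have "D * B2 = B1 * D"
    unfolding D_def B1_def B2_def using U K1 K2
    by (subst (1 2) mult_four_block_mat[of _ p p _ q _ q _ _ p _ q])
       (auto simp: UK2 K1U uminus_mult_left_mat intro!: cong_four_block_mat)
  note ex = mat_exp_intertwine[OF B1 B2 D this]
  define J where "J = (1\<^sub>m p @\<^sub>r 0\<^sub>m q p :: complex mat)"
  have J: "J \<in> carrier_mat m p" unfolding J_def m by auto
  have DJ: "D * J = J" unfolding D_def J_def append_rows_def using U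
    by (subst mult_four_block_mat[of _ p p _ q _ q _ _ p _ 0]) (auto intro!: cong_four_block_mat)
  have app: "append_cols Y Y1 * D = append_cols Y Y2"
    unfolding D_def using Y Y1c Y2c U
    by (subst append_cols_mult_four_block[of _ m p _ q _ p _ q]) (auto simp: one_Y1)
  have ac: "append_cols Y Y1 \<in> carrier_mat m m" "append_cols Y Y2 \<in> carrier_mat m m"
    using append_cols_carrier[OF Y Y1c] append_cols_carrier[OF Y Y2c] m by auto
  have dims: "dim_row Y = m" "dim_col Y = p" using Y by auto
  have "grassmann_exp_rep Y Y2 K2 = append_cols Y Y2 * mat_exp B2 * J"
    by (simp add: grassmann_exp_rep_def dims q_def[symmetric] B2_def J_def Let_def)
  also have "\<dots> = append_cols Y Y1 * (D * mat_exp B2) * J"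
    unfolding app[symmetric] using ac D B2 by (simp add: assoc_mult_mat[of _ m m _ m _ m])
  also have "\<dots> = append_cols Y Y1 * mat_exp B1 * (D * J)"
    unfolding ex
    by (simp only: assoc_mult_mat[OF ac(1) mat_exp_carrier[OF B1] D, symmetric]
        assoc_mult_mat[OF mult_carrier_mat[OF ac(1) mat_exp_carrier[OF B1]] D J])
  also have "\<dots> = grassmann_exp_rep Y Y1 K1"
    by (simp add: grassmann_exp_rep_def dims q_def[symmetric] B1_def DJ J_def[symmetric] Let_def)
  finally show ?thesis by simp
qed

lemma grassmann_exp_eq:
  assumes "Y \<in> carrier_mat m p" "Y' \<in> orth_complements Y" "K \<in> carrier_mat (m - p) p"
  shows "grassmann_exp Y (Y' * K) = grassmann_exp_rep Y Y' K"
  unfolding grassmann_exp_def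
proof (rule the_equality)
  show "\<exists>Y'' K'. Y'' \<in> orth_complements Y \<and> K' \<in> carrier_mat (dim_row Y - dim_col Y) (dim_col Y) \<and>
      Y' * K = Y'' * K' \<and> grassmann_exp_rep Y Y' K = grassmann_exp_rep Y Y'' K'"
    by (rule exI[of _ Y'], rule exI[of _ K]) (use assms in simp)
next
  fix E assume "\<exists>Y'' K'. Y'' \<in> orth_complements Y \<and> K' \<in> carrier_mat (dim_row Y - dim_col Y) (dim_col Y) \<and>
      Y' * K = Y'' * K' \<and> E = grassmann_exp_rep Y Y'' K'"
  then obtain Y'' K' where h: "Y'' \<in> orth_complements Y" "K' \<in> carrier_mat (m - p) p"
    "Y' * K = Y'' * K'" and E: "E = grassmann_exp_rep Y Y'' K'"
    using assms(1) by auto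
  show "E = grassmann_exp_rep Y Y' K"
    unfolding E using grassmann_exp_rep_unique[OF assms h] by (rule sym)
qed

lemma inj_of_full_rank:
  assumes A: "(A :: complex mat) \<in> carrier_mat m p" and r: "vec_space.rank m A = p"
    and v: "v \<in> carrier_vec p" "A *\<^sub>v v = 0\<^sub>v m"
  shows "v = 0\<^sub>v p"
proof -
  interpret vec_space "TYPE(complex)" m .
  have dist: "distinct (cols A)"
  proof (rule ccontr)
    assume nd: "\<not> distinct (cols A)"
    obtain S where S: "maximal S (\<lambda>T. T \<subseteq> set (cols A) \<and> lin_indpt T)"
      using maximal_exists[of "(\<lambda>T. T \<subseteq> set (cols A) \<and> lin_indpt T)" "card (set (cols A))" "{}"]
      by (meson List.finite_set card_mono empty_iff empty_subsetI finite_lin_indpt2 rev_finite_subset)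
    hence "rank A = card S" by (rule rank_card_indpt[OF A])
    also have "\<dots> \<le> card (set (cols A))" using S by (intro card_mono) (auto simp: maximal_def)
    also have "\<dots> < length (cols A)" using nd card_distinct[of "cols A"] card_length[of "cols A"] by linarith
    finally show False using r A by simp
  qed
  from full_rank_lin_indpt[OF A r dist] lin_depI[OF A v(1) _ v(2) dist] show ?thesis by blast
qed

lemma mat_adjoint_smult: "mat_adjoint (c \<cdot>\<^sub>m A) = cnj c \<cdot>\<^sub>m mat_adjoint (A :: complex mat)"
  by (intro eq_matI) auto

lemma qr_exists_aux:
  assumes "(A :: complex mat) \<in> carrier_mat m p"
    and "\<And>X. X \<in> carrier_mat p 1 \<Longrightarrow> A * X = 0\<^sub>m m 1 \<Longrightarrow> X = 0\<^sub>m p 1"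
  shows "\<exists>Q R S. Q \<in> carrier_mat m p \<and> R \<in> carrier_mat p p \<and> S \<in> carrier_mat p p \<and>
     mat_adjoint Q * Q = 1\<^sub>m p \<and> upper_triangular R \<and> A = Q * R \<and> Q = A * S"
  using assms
proof (induction p arbitrary: A)
  case 0
  show ?case
    by (rule exI[of _ A], rule exI[of _ "0\<^sub>m 0 0"], rule exI[of _ "0\<^sub>m 0 0"])
       (use "0.prems"(1) in \<open>auto intro!: eq_matI\<close>)
next
  case (Suc p)
  define A' where "A' = mat m p (\<lambda>(i, j). A $$ (i, j))"
  define a where "a = mat m 1 (\<lambda>(i, j). A $$ (i, p))"
  have A': "A' \<in> carrier_mat m p" and a: "a \<in> carrier_mat m 1" by (simp_all add: A'_def a_def)
  have Aeq: "A = append_cols A' a"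
    using Suc.prems(1) by (intro eq_matI) (auto simp: A'_def a_def append_cols_def less_Suc_eq)
  have mul: "A * (X @\<^sub>r x) = A' * X + a * x" if "X \<in> carrier_mat p 1" "x \<in> carrier_mat 1 1" for X x
  proof -
    have "A * (X @\<^sub>r x) = append_cols (A' * X + a * x) (A' * 0\<^sub>m p 0 + a * 0\<^sub>m 1 0)"
      unfolding Aeq append_rows_def using that
      by (simp add: append_cols_mult_four_block[OF A' a, of _ 1 _ 0])
    also have "\<dots> = A' * X + a * x"
      unfolding append_cols_def using A' a that by (intro eq_matI) auto
    finally show ?thesis .
  qed
  have inj: "X = 0\<^sub>m p 1 \<and> x = 0\<^sub>m 1 1"
    if c: "X \<in> carrier_mat p 1" "x \<in> carrier_mat 1 1" and z: "A' * X + a * x = 0\<^sub>m m 1" for X x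
  proof -
    have "X @\<^sub>r x \<in> carrier_mat (Suc p) 1" using carrier_append_rows[OF c] by simp
    hence "X @\<^sub>r x = 0\<^sub>m (Suc p) 1" using Suc.prems(2) mul[OF c] z by simp
    also have "\<dots> = 0\<^sub>m p 1 @\<^sub>r 0\<^sub>m 1 1" by (intro eq_matI) (auto simp: append_rows_def)
    finally show ?thesis using c
      unfolding append_rows_def by (subst (asm) four_block_eq_iff[of _ p 1 _ 0 _ 1]) auto
  qed
  have "X = 0\<^sub>m p 1" if "X \<in> carrier_mat p 1" "A' * X = 0\<^sub>m m 1" for X
    using inj[of X "0\<^sub>m 1 1"] that A' a by simp
  from Suc.IH[OF A' this] obtain Q R S where
    Q: "Q \<in> carrier_mat m p" and R: "R \<in> carrier_mat p p" and S: "S \<in> carrier_mat p p" and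
    o: "mat_adjoint Q * Q = 1\<^sub>m p" and ut: "upper_triangular R" and QR: "A' = Q * R" and QS: "Q = A' * S"
    by blast
  define w where "w = mat_adjoint Q * a"
  have w: "w \<in> carrier_mat p 1" unfolding w_def using Q a by auto
  define v where "v = a - Q * w"
  have Qw: "Q * w \<in> carrier_mat m 1" using Q w by auto
  have v: "v \<in> carrier_mat m 1" unfolding v_def by (intro minus_carrier_mat Qw)
  have Sw: "S * w \<in> carrier_mat p 1" using S w by auto
  have QwS: "Q * w = A' * (S * w)" unfolding QS using A' S w by simp
  have v0: "v \<noteq> 0\<^sub>m m 1"
  proof
    assume "v = 0\<^sub>m m 1"
    hence "A' * (- (S * w)) + a * 1\<^sub>m 1 = 0\<^sub>m m 1"
      unfolding v_def QwS using A' S w Sw a QwS Qw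
      by (simp add: comm_add_mat[of _ m 1] minus_add_uminus_mat[of _ m 1])
    with inj[of "- (S * w)" "1\<^sub>m 1"] Sw have "1\<^sub>m 1 = (0\<^sub>m 1 1 :: complex mat)" by simp
    hence "1\<^sub>m 1 $$ (0, 0) = (0\<^sub>m 1 1 :: complex mat) $$ (0, 0)" by simp
    thus False by simp
  qed
  define s where "s = (\<Sum>i<m. (cmod (v $$ (i, 0)))\<^sup>2)"
  have "s \<noteq> 0"
  proof
    assume "s = 0"
    hence "\<forall>i<m. v $$ (i, 0) = 0" unfolding s_def by (subst (asm) sum_nonneg_eq_0_iff) auto
    hence "v = 0\<^sub>m m 1" using v by (intro eq_matI) auto
    with v0 show False by simp
  qed
  moreover have "s \<ge> 0" unfolding s_def by (intro sum_nonneg) auto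
  ultimately have s: "s > 0" by simp
  define r where "r = complex_of_real (sqrt s)"
  have r: "r \<noteq> 0" "cnj r = r" "r * r = complex_of_real s"
    using s by (auto simp: r_def simp flip: of_real_mult)
  have vv: "mat_adjoint v * v = complex_of_real s \<cdot>\<^sub>m 1\<^sub>m 1"
    using v by (intro eq_matI)
      (auto simp: scalar_prod_def s_def atLeast0LessThan complex_norm_square mult.commute intro!: sum.cong simp del: of_real_power)
  have Qv: "mat_adjoint Q * v = 0\<^sub>m p 1"
  proof -
    have "mat_adjoint Q * v = w - mat_adjoint Q * (Q * w)"
      unfolding v_def using Q a Qw by (simp add: mult_minus_distrib_mat[of _ p m] w_def)
    also have "mat_adjoint Q * (Q * w) = w"
      using Q w o by (simp add: assoc_mult_mat[of _ p m _ p _ 1, symmetric])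
    finally show ?thesis using w by simp
  qed
  have vQ: "mat_adjoint v * Q = 0\<^sub>m 1 p"
    using arg_cong[OF Qv, of mat_adjoint] Q v
    by (simp add: mat_adjoint_mult[of _ p m] mat_adjoint_adjoint) (auto intro!: eq_matI)
  define u where "u = (1 / r) \<cdot>\<^sub>m v"
  have u: "u \<in> carrier_mat m 1" unfolding u_def using v by auto
  define Q2 where "Q2 = append_cols Q u"
  define R2 where "R2 = four_block_mat R w (0\<^sub>m 1 p) (r \<cdot>\<^sub>m 1\<^sub>m 1)"
  define S2 where "S2 = four_block_mat S (- ((1 / r) \<cdot>\<^sub>m (S * w))) (0\<^sub>m 1 p) ((1 / r) \<cdot>\<^sub>m 1\<^sub>m 1)"
  have ur: "u * (r \<cdot>\<^sub>m 1\<^sub>m 1) = v"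
    unfolding u_def using v r by (auto simp: mult_smult_distrib[of _ m 1] mult_smult_assoc_mat[of _ m 1] intro!: eq_matI)
  have "Q2 \<in> carrier_mat m (Suc p)" using append_cols_carrier[OF Q u] by (simp add: Q2_def)
  moreover have "R2 \<in> carrier_mat (Suc p) (Suc p)" 
    using four_block_carrier_mat[OF R, of "r \<cdot>\<^sub>m 1\<^sub>m 1" 1 1] by (simp add: R2_def)
  moreover have "S2 \<in> carrier_mat (Suc p) (Suc p)" 
    using four_block_carrier_mat[OF S, of "(1 / r) \<cdot>\<^sub>m 1\<^sub>m 1" 1 1] by (simp add: S2_def)
  moreover have "mat_adjoint Q2 * Q2 = 1\<^sub>m (Suc p)"
  proof -
    have "mat_adjoint Q * u = 0\<^sub>m p 1" unfolding u_def using Q v Qv by (simp add: mult_smult_distrib[of _ p m])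
    moreover have "mat_adjoint u * Q = 0\<^sub>m 1 p"
      unfolding u_def mat_adjoint_smult using Q v vQ by (simp add: mult_smult_assoc_mat[of _ 1 m])
    moreover have "mat_adjoint u * u = 1\<^sub>m 1"
      unfolding u_def mat_adjoint_smult using v vv r s
      by (simp add: mult_smult_distrib[of _ 1 m] mult_smult_assoc_mat[of _ 1 m])
         (auto intro!: eq_matI simp: field_simps)
    ultimately show ?thesis
      unfolding Q2_def adjoint_append_cols_mult[OF Q u] using o by simp
  qed
  moreover have "upper_triangular R2"
    using ut R w by (auto simp: R2_def upper_triangular_def)
  moreover have "A = Q2 * R2"
  proof -
    have "Q2 * R2 = append_cols (Q * R + u * 0\<^sub>m 1 p) (Q * w + u * (r \<cdot>\<^sub>m 1\<^sub>m 1))"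
      unfolding Q2_def R2_def using R w by (intro append_cols_mult_four_block[OF Q u]) auto
    also have "Q * R + u * 0\<^sub>m 1 p = A'" using u Q R A' unfolding QR by auto
    also have "Q * w + u * (r \<cdot>\<^sub>m 1\<^sub>m 1) = a" unfolding ur v_def using Q w Qw a by (intro eq_matI) auto
    finally show ?thesis using Aeq by simp
  qed
  moreover have "Q2 = A * S2"
  proof -
    have "A * S2 = append_cols (A' * S + a * 0\<^sub>m 1 p) (A' * (- ((1 / r) \<cdot>\<^sub>m (S * w))) + a * ((1 / r) \<cdot>\<^sub>m 1\<^sub>m 1))"
      unfolding Aeq S2_def
      by (intro append_cols_mult_four_block[OF A' a, of _ p _ 1] S uminus_carrier_mat smult_carrier_mat Sw zero_carrier_mat one_carrier_mat)
    also have "A' * S + a * 0\<^sub>m 1 p = Q" unfolding QS[symmetric] using Q a by simp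
    also have "A' * (- ((1 / r) \<cdot>\<^sub>m (S * w))) + a * ((1 / r) \<cdot>\<^sub>m 1\<^sub>m 1) = u"
    proof -
      have "A' * (- ((1 / r) \<cdot>\<^sub>m (S * w))) = - ((1 / r) \<cdot>\<^sub>m (Q * w))"
        using A' S w Sw by (simp add: mult_smult_distrib[OF A' Sw] QwS)
      moreover have "a * ((1 / r) \<cdot>\<^sub>m 1\<^sub>m 1) = (1 / r) \<cdot>\<^sub>m a"
        unfolding mult_smult_distrib[OF a one_carrier_mat] using a by simp
      ultimately show ?thesis unfolding u_def v_def using a Q w
        by (intro eq_matI) (auto simp: algebra_simps)
    qed
    finally show ?thesis by (simp add: Q2_def)
  qed
  ultimately show ?case by blast
qed

lemma qr_decomposition_exists:
  assumes A: "A \<in> carrier_mat m p" and r: "vec_space.rank m A = p"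
  shows "\<exists>Q R. qr_decomposition A Q R"
proof -
  have "X = 0\<^sub>m p 1" if X: "X \<in> carrier_mat p 1" "A * X = 0\<^sub>m m 1" for X
  proof -
    have "A *\<^sub>v col X 0 = col (A * X) 0" using A X(1) by (intro eq_vecI) auto
    also have "\<dots> = 0\<^sub>v m" unfolding X(2) by auto
    finally have "col X 0 = 0\<^sub>v p"
      using inj_of_full_rank[OF A r, of "col X 0"] X by auto
    show ?thesis
    proof (rule eq_matI)
      fix i j assume "i < dim_row (0\<^sub>m p 1 :: complex mat)" "j < dim_col (0\<^sub>m p 1 :: complex mat)"
      hence ij: "i < p" "j = 0" by auto
      have "X $$ (i, j) = col X 0 $ i" using X ij by simp
      also have "\<dots> = 0" unfolding \<open>col X 0 = 0\<^sub>v p\<close> using ij by simp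
      finally show "X $$ (i, j) = 0\<^sub>m p 1 $$ (i, j)" using ij by simp
    qed (use X in auto)
  qed
  from qr_exists_aux[OF A this] show ?thesis
    using A unfolding qr_decomposition_def orthonormal_cols_def by auto
qed

lemma unitary_entry_le_1:
  assumes V: "V \<in> carrier_mat p p" "unitary_mat V" and ij: "i < p" "j < p"
  shows "cmod (V $$ (i, j)) \<le> 1"
proof -
  have "(\<Sum>k<p. (cmod (V $$ (k, j)))\<^sup>2) = 1"
  proof -
    have "complex_of_real (\<Sum>k<p. (cmod (V $$ (k, j)))\<^sup>2) = (mat_adjoint V * V) $$ (j, j)"
      using V(1) ij by (auto simp: scalar_prod_def atLeast0LessThan complex_norm_square mult.commute
          simp del: of_real_power intro!: sum.cong)
    also have "\<dots> = 1" using V ij by (simp add: unitary_mat_def)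
    finally show ?thesis using of_real_eq_1_iff by blast
  qed
  moreover have "(cmod (V $$ (i, j)))\<^sup>2 \<le> (\<Sum>k<p. (cmod (V $$ (k, j)))\<^sup>2)"
    using ij by (intro member_le_sum) auto
  ultimately show ?thesis by (simp add: power_le_one_iff abs_square_le_1)
qed

definition unit_square :: "complex set" where
  "unit_square = {z. \<bar>Re z\<bar> \<le> 1 \<and> \<bar>Im z\<bar> \<le> 1}"

lemma compact_unit_square: "compact unit_square"
proof -
  have "unit_square = (\<lambda>x. complex_of_real (fst x) + \<i> * complex_of_real (snd x)) ` ({-1..1} \<times> {-1..1})"
  proof (intro equalityI subsetI)
    fix z assume "z \<in> unit_square"
    thus "z \<in> (\<lambda>x. complex_of_real (fst x) + \<i> * complex_of_real (snd x)) ` ({-1..1} \<times> {-1..1})"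
      by (intro image_eqI[of _ _ "(Re z, Im z)"]) (auto simp: unit_square_def complex_eq_iff)
  qed (auto simp: unit_square_def)
  also have "compact \<dots>"
    by (intro compact_continuous_image compact_Times compact_Icc continuous_intros)
  finally show ?thesis .
qed

lemma compact_unitary:
  "compact {f \<in> PiE UNIV (\<lambda>_. unit_square). unitary_mat (mat p p (f :: nat \<times> nat \<Rightarrow> complex))}"
proof -
  have cont: "continuous_on UNIV (\<lambda>f :: nat \<times> nat \<Rightarrow> complex. f x)" for x
    by (rule continuous_on_product_coordinates)
  have "compactin (product_topology (\<lambda>_. euclidean) UNIV) (PiE UNIV (\<lambda>_ :: nat \<times> nat. unit_square))"
    by (subst compactin_PiE) (auto simp: compact_unit_square)
  hence "compact (PiE UNIV (\<lambda>_ :: nat \<times> nat. unit_square))"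
    by (simp add: euclidean_product_topology)
  moreover have "closed {f :: nat \<times> nat \<Rightarrow> complex. unitary_mat (mat p p f)}"
  proof -
    have "{f :: nat \<times> nat \<Rightarrow> complex. unitary_mat (mat p p f)} =
      (\<Inter>i\<in>{..<p}. \<Inter>j\<in>{..<p}. {f. (\<Sum>k<p. cnj (f (k, i)) * f (k, j)) = (if i = j then 1 else 0)})"
      by (auto simp: unitary_mat_def mat_eq_iff scalar_prod_def atLeast0LessThan)
    thus ?thesis
      by (simp only:) (intro closed_INT ballI closed_Collect_eq continuous_intros cont)
  qed
  ultimately show ?thesis
    by (simp add: Collect_conj_eq compact_Int_closed)
qed

lemma grassmann_dist_attained:
  assumes X: "X \<in> carrier_mat m p" and Y: "Y \<in> carrier_mat m p"
  obtains V W where "V \<in> carrier_mat p p" "unitary_mat V" "W \<in> carrier_mat p p" "unitary_mat W"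
    "grassmann_dist X Y = frobenius_norm (X * V - Y * W)"
    "\<And>V' W'. \<lbrakk>V' \<in> carrier_mat p p; unitary_mat V'; W' \<in> carrier_mat p p; unitary_mat W'\<rbrakk> \<Longrightarrow>
       grassmann_dist X Y \<le> frobenius_norm (X * V' - Y * W')"
proof -
  define C where "C = {f \<in> PiE UNIV (\<lambda>_. unit_square). unitary_mat (mat p p (f :: nat \<times> nat \<Rightarrow> complex))}"
  define \<phi> where "\<phi> = (\<lambda>(f, g). frobenius_norm (X * mat p p f - Y * mat p p g))"
  have C: "compact (C \<times> C)" unfolding C_def by (intro compact_Times compact_unitary)
  have surj: "\<exists>f\<in>C. V = mat p p f" if "V \<in> carrier_mat p p" "unitary_mat V" for V
  proof -
    define f where "f = (\<lambda>(i, j). if i < p \<and> j < p then V $$ (i, j) else 0)"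
    have "V = mat p p f" using that by (intro eq_matI) (auto simp: f_def)
    moreover have "f \<in> PiE UNIV (\<lambda>_. unit_square)"
      using order_trans[OF abs_Re_le_cmod unitary_entry_le_1[OF that]]
        order_trans[OF abs_Im_le_cmod unitary_entry_le_1[OF that]]
      by (auto simp: f_def unit_square_def)
    ultimately show ?thesis using that unfolding C_def by blast
  qed
  have "unitary_mat (1\<^sub>m p)" by (auto simp: unitary_mat_def mat_eq_iff scalar_prod_def intro!: sum.delta)
  with surj[of "1\<^sub>m p"] have ne: "C \<times> C \<noteq> {}" by auto
  have c1: "continuous_on S (\<lambda>x. fst x k)" for S :: "((nat \<times> nat \<Rightarrow> complex) \<times> (nat \<times> nat \<Rightarrow> complex)) set" and k
    by (rule continuous_on_product_then_coordinatewise) (intro continuous_intros)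
  have c2: "continuous_on S (\<lambda>x. snd x k)" for S :: "((nat \<times> nat \<Rightarrow> complex) \<times> (nat \<times> nat \<Rightarrow> complex)) set" and k
    by (rule continuous_on_product_then_coordinatewise) (intro continuous_intros)
  have phi: "\<phi> = (\<lambda>x. sqrt (\<Sum>i<m. \<Sum>j<p. (cmod ((\<Sum>k<p. X $$ (i, k) * fst x (k, j)) -
         (\<Sum>k<p. Y $$ (i, k) * snd x (k, j))))\<^sup>2))"
    unfolding \<phi>_def frobenius_norm_def using X Y
    by (auto simp: fun_eq_iff scalar_prod_def atLeast0LessThan intro!: sum.cong)
  have "continuous_on (C \<times> C) \<phi>"
    unfolding phi by (intro continuous_intros c1 c2)
  from continuous_attains_inf[OF C ne this] obtain f g where
    fg: "f \<in> C" "g \<in> C" "\<And>f' g'. f' \<in> C \<Longrightarrow> g' \<in> C \<Longrightarrow> \<phi> (f, g) \<le> \<phi> (f', g')" by auto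
  have low: "frobenius_norm (X * mat p p f - Y * mat p p g) \<le> frobenius_norm (X * V' - Y * W')"
    if "V' \<in> carrier_mat p p" "unitary_mat V'" "W' \<in> carrier_mat p p" "unitary_mat W'" for V' W'
    using surj[OF that(1,2)] surj[OF that(3,4)] fg(3) by (auto simp: \<phi>_def)
  have eq: "grassmann_dist X Y = frobenius_norm (X * mat p p f - Y * mat p p g)"
    unfolding grassmann_dist_def
    by (rule cInf_eq_minimum) (use X Y low fg(1,2) in \<open>auto simp: C_def, (metis mat_carrier)?\<close>)
  show ?thesis
    by (rule that[of "mat p p f" "mat p p g"]) (use fg low eq in \<open>auto simp: C_def\<close>)
qed

end

theory Submission
  imports Defs "HOL-Analysis.L2_Norm"
begin

text \<open>Let \<open>B\<close> be the skew-Hermitian block matrix of \<open>K\<close>, \<open>U = (Y Y\<^sub>\<bottom>)\<close>, \<open>J = (I 0)\<^sup>T\<close> and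
  \<open>\<theta>(z) = \<Sum> a\<^sub>k z\<^sup>k\<close>.  Since \<open>B\<^sup>2 J = - J K\<^sup>* K\<close>, the argument of \<open>\<Q>\<close> is \<open>A = U \<theta>(tB) J\<close>, while the
  exponential is \<open>E = U exp(tB) J\<close>.  The component of \<open>A\<close> orthogonal to \<open>E\<close> is the lower left block of
  \<open>exp(- tB) \<theta>(tB)\<close>.  Even powers of \<open>B\<close> are block diagonal, and the coefficients of \<open>exp(- z) \<theta>(z)\<close> at
  the odd powers below \<open>2n\<close> vanish because \<open>\<theta>(z) / \<theta>(- z)\<close> is a Pade approximant of \<open>exp(2z)\<close>; so that
  block is \<open>O(t\<^sup>2\<^sup>n\<^sup>+\<^sup>1)\<close>.  Finally, an upper triangular matrix whose Gram matrix is close to \<open>I\<close> is close to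
  a diagonal unitary matrix; this turns the bound on the orthogonal component into one on the distance.\<close>

section \<open>Entrywise Landau bounds for matrices\<close>

text \<open>The bound \<open>g\<close> is complex valued because the Landau symbols relate functions of one type.\<close>

definition mat_bigo :: "'a filter \<Rightarrow> nat \<Rightarrow> nat \<Rightarrow> ('a \<Rightarrow> complex) \<Rightarrow> ('a \<Rightarrow> complex mat) \<Rightarrow> bool" where
  "mat_bigo F m p g X \<longleftrightarrow> (\<forall>\<^sub>F t in F. X t \<in> carrier_mat m p) \<and>
     (\<forall>i<m. \<forall>j<p. (\<lambda>t. X t $$ (i, j)) \<in> O[F](g))"

lemma mat_bigoI:
  assumes "\<forall>\<^sub>F t in F. X t \<in> carrier_mat m p"
    and "\<And>i j. i < m \<Longrightarrow> j < p \<Longrightarrow> (\<lambda>t. X t $$ (i, j)) \<in> O[F](g)"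
  shows "mat_bigo F m p g X"
  using assms by (simp add: mat_bigo_def)

lemma mat_bigoD:
  assumes "mat_bigo F m p g X"
  shows "\<forall>\<^sub>F t in F. X t \<in> carrier_mat m p"
    and "i < m \<Longrightarrow> j < p \<Longrightarrow> (\<lambda>t. X t $$ (i, j)) \<in> O[F](g)"
  using assms by (simp_all add: mat_bigo_def)

lemma mat_bigo_cong:
  assumes "\<forall>\<^sub>F t in F. X t = Y t"
  shows "mat_bigo F m p g X \<longleftrightarrow> mat_bigo F m p g Y"
proof -
  have "(\<forall>\<^sub>F t in F. X t \<in> carrier_mat m p) \<longleftrightarrow> (\<forall>\<^sub>F t in F. Y t \<in> carrier_mat m p)"
    by (rule eventually_cong[OF assms]) simp
  moreover have "(\<lambda>t. X t $$ (i, j)) \<in> O[F](g) \<longleftrightarrow> (\<lambda>t. Y t $$ (i, j)) \<in> O[F](g)" for i j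
    by (rule landau_o.big.in_cong) (use assms in \<open>auto elim: eventually_mono\<close>)
  ultimately show ?thesis by (simp add: mat_bigo_def)
qed

text \<open>Dimensions and identities are required only eventually, because factors such as
  \<open>R\<close> are controlled only where a Gram determinant is nonzero.\<close>

lemma mat_bigo_ev_eq:
  assumes "mat_bigo F m p g X" "\<forall>\<^sub>F t in F. X t = Y t"
  shows "mat_bigo F m p g Y"
  using mat_bigo_cong[OF assms(2)] assms(1) by simp

lemma mat_bigo_trans:
  assumes "mat_bigo F m p f X" "f \<in> O[F](g)"
  shows "mat_bigo F m p g X"
  using assms by (auto simp: mat_bigo_def intro: landau_o.big_trans)

lemma mat_bigo_add:
  assumes X: "mat_bigo F m p g X" and Y: "mat_bigo F m p g Y"
  shows "mat_bigo F m p g (\<lambda>t. X t + Y t)"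
proof (rule mat_bigoI)
  show "\<forall>\<^sub>F t in F. X t + Y t \<in> carrier_mat m p"
    using mat_bigoD(1)[OF Y] by eventually_elim simp
  fix i j assume ij: "i < m" "j < p"
  have "\<forall>\<^sub>F t in F. (X t + Y t) $$ (i, j) = X t $$ (i, j) + Y t $$ (i, j)"
    using mat_bigoD(1)[OF X] mat_bigoD(1)[OF Y] by eventually_elim (use ij in simp)
  moreover have "(\<lambda>t. X t $$ (i, j) + Y t $$ (i, j)) \<in> O[F](g)"
    by (intro sum_in_bigo mat_bigoD(2)[OF X] mat_bigoD(2)[OF Y] ij)
  ultimately show "(\<lambda>t. (X t + Y t) $$ (i, j)) \<in> O[F](g)"
    using landau_o.big.in_cong by fastforce
qed

lemma mat_bigo_uminus:
  assumes X: "mat_bigo F m p g X"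
  shows "mat_bigo F m p g (\<lambda>t. - X t)"
proof (rule mat_bigoI)
  show "\<forall>\<^sub>F t in F. - X t \<in> carrier_mat m p"
    using mat_bigoD(1)[OF X] by eventually_elim simp
  fix i j assume ij: "i < m" "j < p"
  have "\<forall>\<^sub>F t in F. (- X t) $$ (i, j) = - X t $$ (i, j)"
    using mat_bigoD(1)[OF X] by eventually_elim (use ij in simp)
  moreover have "(\<lambda>t. - X t $$ (i, j)) \<in> O[F](g)"
    using mat_bigoD(2)[OF X ij] by simp
  ultimately show "(\<lambda>t. (- X t) $$ (i, j)) \<in> O[F](g)"
    using landau_o.big.in_cong by fastforce
qed

lemma mat_bigo_mult:
  assumes X: "mat_bigo F m k f X" and Y: "mat_bigo F k p g Y"
  shows "mat_bigo F m p (\<lambda>t. f t * g t) (\<lambda>t. X t * Y t)"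
proof (rule mat_bigoI)
  show "\<forall>\<^sub>F t in F. X t * Y t \<in> carrier_mat m p"
    using mat_bigoD(1)[OF X] mat_bigoD(1)[OF Y] by eventually_elim simp
  fix i j assume ij: "i < m" "j < p"
  have "\<forall>\<^sub>F t in F. (X t * Y t) $$ (i, j) = (\<Sum>l<k. X t $$ (i, l) * Y t $$ (l, j))"
    using mat_bigoD(1)[OF X] mat_bigoD(1)[OF Y] 
    by eventually_elim (use ij in \<open>auto simp: scalar_prod_def atLeast0LessThan\<close>)
  moreover have "(\<lambda>t. \<Sum>l<k. X t $$ (i, l) * Y t $$ (l, j)) \<in> O[F](\<lambda>t. f t * g t)"
    by (intro big_sum_in_bigo landau_o.big.mult mat_bigoD(2)[OF X] mat_bigoD(2)[OF Y] ij) auto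
  ultimately show "(\<lambda>t. (X t * Y t) $$ (i, j)) \<in> O[F](\<lambda>t. f t * g t)"
    using landau_o.big.in_cong by fastforce
qed

lemma mat_bigo_adjoint:
  assumes X: "mat_bigo F m p g X"
  shows "mat_bigo F p m g (\<lambda>t. mat_adjoint (X t))"
proof (rule mat_bigoI)
  show "\<forall>\<^sub>F t in F. mat_adjoint (X t) \<in> carrier_mat p m"
    using mat_bigoD(1)[OF X] by eventually_elim simp
  fix i j assume ij: "i < p" "j < m"
  have "\<forall>\<^sub>F t in F. mat_adjoint (X t) $$ (i, j) = cnj (X t $$ (j, i))"
    using mat_bigoD(1)[OF X] by eventually_elim (use ij in simp)
  moreover have "(\<lambda>t. cnj (X t $$ (j, i))) \<in> O[F](g)"
    using mat_bigoD(2)[OF X ij(2,1)] by (simp add: bigo_def)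
  ultimately show "(\<lambda>t. mat_adjoint (X t) $$ (i, j)) \<in> O[F](g)"
    using landau_o.big.in_cong by fastforce
qed

section \<open>Orthonormal columns and the Frobenius norm\<close>

lemma sum_cmod_col_eq_gram:
  assumes "A \<in> carrier_mat m p" "j < p"
  shows "complex_of_real (\<Sum>i<m. (cmod (A $$ (i, j)))\<^sup>2) = (mat_adjoint A * A) $$ (j, j)"
  using assms by (auto simp: scalar_prod_def atLeast0LessThan complex_norm_square mult.commute
          simp del: of_real_power intro!: sum.cong)

text \<open>Each column has squared norm equal to a diagonal entry of the Gram matrix, that is,
  1.\<close>

lemma orthonormal_entry_le_1:
  assumes "A \<in> carrier_mat m p" "mat_adjoint A * A = 1\<^sub>m p" "i < m" "j < p"
  shows "cmod (A $$ (i, j)) \<le> 1"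
proof -
  have "(\<Sum>k<m. (cmod (A $$ (k, j)))\<^sup>2) = 1"
    using sum_cmod_col_eq_gram[OF assms(1,4)] assms of_real_eq_1_iff by fastforce
  moreover have "(cmod (A $$ (i, j)))\<^sup>2 \<le> (\<Sum>k<m. (cmod (A $$ (k, j)))\<^sup>2)"
    using assms by (intro member_le_sum) auto
  ultimately show ?thesis by (simp add: power_le_one_iff abs_square_le_1)
qed

text \<open>Boundedness comes from orthonormality alone. This matters for factors such as
  \<open>W\<close> in \<open>grassmann_dist_bigo\<close>, which are picked separately for each
  \<open>t\<close> with no continuity in \<open>t\<close>.\<close>

lemma mat_bigo_orthonormal:
  assumes "\<forall>\<^sub>F t in F. X t \<in> carrier_mat m p \<and> mat_adjoint (X t) * X t = 1\<^sub>m p"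
  shows "mat_bigo F m p (\<lambda>_. 1) X"
proof (rule mat_bigoI)
  show "\<forall>\<^sub>F t in F. X t \<in> carrier_mat m p" using assms by eventually_elim simp
  fix i j assume ij: "i < m" "j < p"
  have "\<forall>\<^sub>F t in F. norm (X t $$ (i, j)) \<le> 1 * norm (1 :: complex)"
    using assms by eventually_elim (use ij orthonormal_entry_le_1 in auto)
  thus "(\<lambda>t. X t $$ (i, j)) \<in> O[F](\<lambda>_. 1)" by (rule bigoI)
qed

text \<open>The l2 norm of the family of entries is at most its l1 norm.\<close>

lemma frobenius_norm_le_sum:
  "frobenius_norm A \<le> (\<Sum>i<dim_row A. \<Sum>j<dim_col A. cmod (A $$ (i, j)))"
  using L2_set_le_sum[of "{..<dim_row A} \<times> {..<dim_col A}" "\<lambda>x. cmod (A $$ x)"]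
  by (simp add: frobenius_norm_def L2_set_def sum.cartesian_product case_prod_unfold)

lemma frobenius_norm_bigo:
  assumes X: "mat_bigo F m p g X"
  shows "(\<lambda>t. frobenius_norm (X t)) \<in> O[F](\<lambda>t. cmod (g t))"
proof -
  have "\<forall>\<^sub>F t in F. norm (frobenius_norm (X t)) \<le> 1 * norm (\<Sum>i<m. \<Sum>j<p. cmod (X t $$ (i, j)))"
    using mat_bigoD(1)[OF X]
  proof eventually_elim
    case (elim t)
    have "0 \<le> frobenius_norm (X t)" by (simp add: frobenius_norm_def sum_nonneg)
    thus ?case using frobenius_norm_le_sum[of "X t"] elim by simp
  qed
  hence "(\<lambda>t. frobenius_norm (X t)) \<in> O[F](\<lambda>t. \<Sum>i<m. \<Sum>j<p. cmod (X t $$ (i, j)))" by (rule bigoI)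
  also have "(\<lambda>t. \<Sum>i<m. \<Sum>j<p. cmod (X t $$ (i, j))) \<in> O[F](\<lambda>t. cmod (g t))"
    by (intro big_sum_in_bigo) (simp add: mat_bigoD(2)[OF X])
  finally show ?thesis .
qed

section \<open>Scalar bounds by functions that tend to zero\<close>

lemma bigo_tendsto_zero:
  fixes f g :: "'a \<Rightarrow> 'b :: real_normed_field"
  assumes "f \<in> O[F](g)" "(g \<longlongrightarrow> 0) F"
  shows "(f \<longlongrightarrow> 0) F"
proof -
  have "g \<in> o[F](\<lambda>_. 1)" using assms(2) by (intro smalloI_tendsto) auto
  with assms(1) have "f \<in> o[F](\<lambda>_. 1)" by (rule landau_o.big_small_trans)
  from smalloD_tendsto[OF this] show ?thesis by simp
qed

lemma mult_bigo_right:
  fixes f g h :: "'a \<Rightarrow> 'b :: real_normed_field"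
  assumes "f \<in> O[F](g)" "h \<in> O[F](\<lambda>_. 1)"
  shows "(\<lambda>t. f t * h t) \<in> O[F](g)"
  using landau_o.big.mult[OF assms] by simp

lemma tendsto_zero_imp_bigo_1:
  fixes g :: "'a \<Rightarrow> 'b :: real_normed_field"
  assumes "(g \<longlongrightarrow> 0) F"
  shows "g \<in> O[F](\<lambda>_. 1)"
  by (rule landau_o.small_imp_big, rule smalloI_tendsto) (use assms in auto)

section \<open>Triangular factors of nearly orthonormal matrices\<close>

text \<open>Together with \<open>bigo_cancel_factor\<close> this permits division by diagonal
  entries when triangular systems are solved.\<close>

lemma diagonal_cmod_ge_half:
  fixes z :: "'a \<Rightarrow> complex"
  assumes "(\<lambda>t. complex_of_real (cmod (z t) - 1)) \<in> O[F](g)" "(g \<longlongrightarrow> 0) F"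
  shows "\<forall>\<^sub>F t in F. 1/2 \<le> cmod (z t)"
proof -
  have "((\<lambda>t. complex_of_real (cmod (z t) - 1)) \<longlongrightarrow> 0) F"
    by (rule bigo_tendsto_zero[OF assms])
  hence "\<forall>\<^sub>F t in F. dist (complex_of_real (cmod (z t) - 1)) 0 < 1/2"
    by (rule tendstoD) simp
  thus ?thesis
  proof eventually_elim
    case (elim t)
    hence "\<bar>cmod (z t) - 1\<bar> < 1/2" by (simp only: dist_norm diff_0_right norm_of_real)
    thus ?case by arith
  qed
qed

lemma bigo_cancel_factor:
  fixes f z :: "'a \<Rightarrow> complex"
  assumes half: "\<forall>\<^sub>F t in F. 1/2 \<le> cmod (z t)" and fz: "(\<lambda>t. f t * z t) \<in> O[F](g)"
  shows "f \<in> O[F](g)"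
proof -
  have "\<forall>\<^sub>F t in F. norm (f t) \<le> 2 * norm (f t * z t)"
    using half
  proof eventually_elim
    case (elim t)
    have "cmod (f t) * (1/2) \<le> cmod (f t) * cmod (z t)"
      using elim by (intro mult_left_mono) auto
    thus ?case by (simp add: norm_mult)
  qed
  hence "f \<in> O[F](\<lambda>t. f t * z t)" by (rule bigoI)
  thus ?thesis using fz by (rule landau_o.big_trans)
qed

text \<open>The equation \<open>(T\<^sup>* T)\<^sub>i\<^sub>j = cnj T\<^sub>i\<^sub>i T\<^sub>i\<^sub>j + (terms from rows above i)\<close> is solved row by row.\<close>

lemma upper_triangular_gram_bigo:
  assumes ev: "\<forall>\<^sub>F t in F. T t \<in> carrier_mat p p \<and> upper_triangular (T t)"
    and gram: "mat_bigo F p p g (\<lambda>t. mat_adjoint (T t) * T t - 1\<^sub>m p)"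
    and g0: "(g \<longlongrightarrow> 0) F"
  shows "i < j \<Longrightarrow> j < p \<Longrightarrow> (\<lambda>t. T t $$ (i, j)) \<in> O[F](g)"
    and "i < p \<Longrightarrow> (\<lambda>t. complex_of_real (cmod (T t $$ (i, i)) - 1)) \<in> O[F](g)"
proof -
  have *: "(\<forall>j. i < j \<longrightarrow> j < p \<longrightarrow> (\<lambda>t. T t $$ (i, j)) \<in> O[F](g)) \<and>
    (\<lambda>t. complex_of_real (cmod (T t $$ (i, i)) - 1)) \<in> O[F](g)" if "i < p" for i
    using that
  proof (induction i rule: less_induct)
    case (less i)
    have row: "(\<lambda>t. cnj (T t $$ (i, i)) * T t $$ (i, j) - (if i = j then 1 else 0)) \<in> O[F](g)"
      if ij: "i \<le> j" "j < p" for j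
    proof -
      \<comment> \<open>For \<open>k < i \<le> j\<close> both entries in row \<open>k\<close> lie
        strictly above the diagonal, so the induction hypothesis bounds both. One factor supplies
        the rate \<open>g\<close>; the other need only be bounded.\<close>
      have "(\<lambda>t. cnj (T t $$ (k, i)) * T t $$ (k, j)) \<in> O[F](g)" if k: "k < i" for k
      proof -
        have ki: "(\<lambda>t. T t $$ (k, i)) \<in> O[F](g)" and kj: "(\<lambda>t. T t $$ (k, j)) \<in> O[F](g)"
          using less.IH[OF k] k less.prems ij by auto
        have "(\<lambda>t. cnj (T t $$ (k, i))) \<in> O[F](\<lambda>_. 1)"
          using landau_o.big_trans[OF ki tendsto_zero_imp_bigo_1[OF g0]] by (simp add: bigo_def)
        from mult_bigo_right[OF kj this] show ?thesis by (simp add: mult.commute)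
      qed
      hence sm: "(\<lambda>t. \<Sum>k<i. cnj (T t $$ (k, i)) * T t $$ (k, j)) \<in> O[F](g)"
        by (intro big_sum_in_bigo) auto
      have "\<forall>\<^sub>F t in F. (mat_adjoint (T t) * T t - 1\<^sub>m p) $$ (i, j) - (\<Sum>k<i. cnj (T t $$ (k, i)) * T t $$ (k, j))
        = cnj (T t $$ (i, i)) * T t $$ (i, j) - (if i = j then 1 else 0)"
        using ev
      proof eventually_elim
        case (elim t)
        have "(mat_adjoint (T t) * T t) $$ (i, j) = (\<Sum>k<p. cnj (T t $$ (k, i)) * T t $$ (k, j))"
          using elim ij by (auto simp: scalar_prod_def atLeast0LessThan)
        \<comment> \<open>Column \<open>i\<close> of \<open>T t\<close> vanishes below row
          \<open>i\<close>, so only the rows up to \<open>i\<close> contribute.\<close>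
        also have "\<dots> = (\<Sum>k<Suc i. cnj (T t $$ (k, i)) * T t $$ (k, j))"
          using elim ij less.prems by (intro sum.mono_neutral_right) (auto simp: upper_triangular_def)
        finally show ?case using elim ij less.prems by auto
      qed
      from landau_o.big.in_cong[OF this] 
        sum_in_bigo(2)[OF mat_bigoD(2)[OF gram less.prems ij(2)] sm]
      show ?thesis by blast
    qed
    have sq: "(\<lambda>t. cnj (T t $$ (i, i)) * T t $$ (i, i) - 1) \<in> O[F](g)"
      using row[OF order_refl less.prems] by simp
    have sq_eq: "cnj z * z - 1 = complex_of_real ((cmod z)\<^sup>2 - 1)" for z
      by (simp add: complex_norm_square mult.commute del: of_real_power)
    \<comment> \<open>The modulus is nonnegative, so \<open>\<bar>x - 1\<bar> \<le> \<bar>x -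
      1\<bar> * \<bar>x + 1\<bar> = \<bar>x\<^sup>2 - 1\<bar>\<close>: a bound on the squared
      modulus carries over to the modulus.\<close>
    have "(\<lambda>t. complex_of_real (cmod (T t $$ (i, i)) - 1)) \<in> O[F](\<lambda>t. cnj (T t $$ (i, i)) * T t $$ (i, i) - 1)"
    proof (rule bigoI[of _ 1], rule always_eventually, rule allI)
      fix t
      let ?x = "cmod (T t $$ (i, i))"
      have "\<bar>?x - 1\<bar> \<le> \<bar>?x - 1\<bar> * \<bar>?x + 1\<bar>" by (simp add: mult_le_cancel_left1)
      also have "\<dots> = \<bar>?x\<^sup>2 - 1\<bar>"
        by (simp only: abs_mult[symmetric]) (simp add: power2_eq_square algebra_simps)
      finally show "norm (complex_of_real (?x - 1)) \<le> 1 * norm (cnj (T t $$ (i, i)) * T t $$ (i, i) - 1)"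
        unfolding sq_eq norm_of_real by simp
    qed
    hence diag: "(\<lambda>t. complex_of_real (cmod (T t $$ (i, i)) - 1)) \<in> O[F](g)"
      using sq by (rule landau_o.big_trans)
    have "(\<lambda>t. T t $$ (i, j)) \<in> O[F](g)" if ij: "i < j" "j < p" for j
    proof (rule bigo_cancel_factor)
      show "\<forall>\<^sub>F t in F. 1/2 \<le> cmod (cnj (T t $$ (i, i)))"
        using diagonal_cmod_ge_half[OF diag g0] by simp
      show "(\<lambda>t. T t $$ (i, j) * cnj (T t $$ (i, i))) \<in> O[F](g)"
        using row[of j] ij by (simp add: mult.commute)
    qed
    with diag show ?case by blast
  qed
  show "i < j \<Longrightarrow> j < p \<Longrightarrow> (\<lambda>t. T t $$ (i, j)) \<in> O[F](g)" using *[of i] by simp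
  show "i < p \<Longrightarrow> (\<lambda>t. complex_of_real (cmod (T t $$ (i, i)) - 1)) \<in> O[F](g)" using *[of i] by simp
qed

text \<open>Forward substitution over the columns: column \<open>j\<close> of \<open>N R\<close> is
  \<open>R\<^sub>j\<^sub>j\<close> times column \<open>j\<close> of \<open>N\<close> plus multiples
  of earlier columns of \<open>N\<close>. The rate \<open>h\<close> only keeps the diagonal of
  \<open>R\<close> away from zero and its other entries bounded, so \<open>g\<close> may be far
  smaller than \<open>h\<close>.\<close>

lemma triangular_solve_bigo:
  assumes N: "\<forall>\<^sub>F t in F. N t \<in> carrier_mat q p"
    and ev: "\<forall>\<^sub>F t in F. R t \<in> carrier_mat p p \<and> upper_triangular (R t)"
    and gram: "mat_bigo F p p h (\<lambda>t. mat_adjoint (R t) * R t - 1\<^sub>m p)"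
    and h0: "(h \<longlongrightarrow> 0) F"
    and NR: "mat_bigo F q p g (\<lambda>t. N t * R t)"
  shows "mat_bigo F q p g N"
proof (rule mat_bigoI[OF N])
  note tri = upper_triangular_gram_bigo[OF ev gram h0]
  fix i j assume i: "i < q" and "j < p"
  thus "(\<lambda>t. N t $$ (i, j)) \<in> O[F](g)"
  proof (induction j rule: less_induct)
    case (less j)
    have "(\<lambda>t. N t $$ (i, k) * R t $$ (k, j)) \<in> O[F](g)" if "k < j" for k
      by (rule mult_bigo_right)
        (use that less tri(1)[of k j] in \<open>auto intro: landau_o.big_trans tendsto_zero_imp_bigo_1[OF h0]\<close>)
    hence sm: "(\<lambda>t. \<Sum>k<j. N t $$ (i, k) * R t $$ (k, j)) \<in> O[F](g)"
      by (intro big_sum_in_bigo) auto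
    have "\<forall>\<^sub>F t in F. (N t * R t) $$ (i, j) - (\<Sum>k<j. N t $$ (i, k) * R t $$ (k, j))
        = N t $$ (i, j) * R t $$ (j, j)"
      using N ev
    proof eventually_elim
      case (elim t)
      have "(N t * R t) $$ (i, j) = (\<Sum>k<p. N t $$ (i, k) * R t $$ (k, j))"
        using elim i less.prems by (auto simp: scalar_prod_def atLeast0LessThan)
      also have "\<dots> = (\<Sum>k<Suc j. N t $$ (i, k) * R t $$ (k, j))"
        using elim less.prems by (intro sum.mono_neutral_right) (auto simp: upper_triangular_def)
      finally show ?case by simp
    qed
    from landau_o.big.in_cong[OF this] sum_in_bigo(2)[OF mat_bigoD(2)[OF NR i less.prems(2)] sm]
    have "(\<lambda>t. N t $$ (i, j) * R t $$ (j, j)) \<in> O[F](g)" by blast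
    thus ?case
      by (rule bigo_cancel_factor[OF diagonal_cmod_ge_half[OF tri(2)[OF less.prems(2)] h0]])
  qed
qed

section \<open>Gram determinants, injectivity and rank\<close>

lemma det_gram_nonzero_imp_inj:
  assumes A: "(A :: complex mat) \<in> carrier_mat m p" and d: "det (mat_adjoint A * A) \<noteq> 0"
    and v: "v \<in> carrier_vec p" "A *\<^sub>v v = 0\<^sub>v m"
  shows "v = 0\<^sub>v p"
proof (rule ccontr)
  assume "v \<noteq> 0\<^sub>v p"
  moreover have "(mat_adjoint A * A) *\<^sub>v v = 0\<^sub>v p"
    using assoc_mult_mat_vec[of "mat_adjoint A" p m A p v] A v by auto
  ultimately show False
    using d v(1) det_0_iff_vec_prod_zero_field[OF mult_carrier_mat[OF mat_adjoint_carrier[OF A] A]] by auto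
qed

text \<open>Linear independence is a property of the set of columns, so distinctness is settled
  first: equal columns of \<open>A\<close> would give equal columns of the Gram matrix and hence
  determinant zero. Independence then follows from injectivity.\<close>

lemma det_gram_nonzero_imp_rank:
  assumes A: "(A :: complex mat) \<in> carrier_mat m p" and d: "det (mat_adjoint A * A) \<noteq> 0"
  shows "vec_space.rank m A = p"
proof -
  interpret vec_space "TYPE(complex)" m .
  have dist: "distinct (cols A)"
  proof (rule ccontr)
    assume "\<not> distinct (cols A)"
    then obtain i j where ij: "i \<noteq> j" "i < p" "j < p" "col A i = col A j"
      using A by (auto simp: distinct_conv_nth)
    have "col (mat_adjoint A * A) i = col (mat_adjoint A * A) j"
      using ij A by (intro eq_vecI) auto
    with det_identical_cols[OF mult_carrier_mat[OF mat_adjoint_carrier[OF A] A] ij(1-3)] d show False by simp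
  qed
  have "\<not> lin_dep (set (cols A))"
    using lin_depE[OF A _ dist] det_gram_nonzero_imp_inj[OF A d] by metis
  thus ?thesis by (rule lin_indpt_full_rank[OF A dist])
qed

text \<open>Vectors appear as one-column matrices to match the hypothesis of
  \<open>qr_exists_aux\<close>.\<close>

lemma det_gram_nonzero_imp_inj_mat:
  assumes A: "(A :: complex mat) \<in> carrier_mat m p" and d: "det (mat_adjoint A * A) \<noteq> 0"
    and X: "X \<in> carrier_mat p 1" "A * X = 0\<^sub>m m 1"
  shows "X = 0\<^sub>m p 1"
proof -
  have "A *\<^sub>v col X 0 = col (A * X) 0" using A X(1) by (intro eq_vecI) auto
  also have "\<dots> = 0\<^sub>v m" unfolding X(2) by auto
  finally have c: "col X 0 = 0\<^sub>v p"
    using det_gram_nonzero_imp_inj[OF A d, of "col X 0"] X by auto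
  have "X $$ (i, 0) = 0" if "i < p" for i
    using arg_cong[OF c, of "\<lambda>v. v $ i"] that X by simp
  thus ?thesis using X by (intro eq_matI) auto
qed

text \<open>By the Leibniz formula the determinant is a polynomial in the entries, so it tends to
  the determinant of the identity.\<close>

lemma eventually_det_nonzero:
  fixes M :: "'a \<Rightarrow> complex mat"
  assumes M: "\<forall>\<^sub>F t in F. M t \<in> carrier_mat p p"
    and near: "mat_bigo F p p g (\<lambda>t. M t - 1\<^sub>m p)" and g0: "(g \<longlongrightarrow> 0) F"
  shows "\<forall>\<^sub>F t in F. det (M t) \<noteq> 0"
proof -
  have ent: "((\<lambda>t. M t $$ (i, j)) \<longlongrightarrow> 1\<^sub>m p $$ (i, j)) F" if ij: "i < p" "j < p" for i j
  proof -
    have "((\<lambda>t. (M t - 1\<^sub>m p) $$ (i, j)) \<longlongrightarrow> 0) F"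
      by (rule bigo_tendsto_zero[OF mat_bigoD(2)[OF near ij] g0])
    hence "((\<lambda>t. M t $$ (i, j) - 1\<^sub>m p $$ (i, j)) \<longlongrightarrow> 0) F"
      by (rule Lim_transform_eventually) (use M ij in \<open>auto elim: eventually_mono\<close>)
    thus ?thesis by (simp only: LIM_zero_iff)
  qed
  let ?d = "\<lambda>M :: complex mat. \<Sum>\<pi> | \<pi> permutes {0..<p}. signof \<pi> * (\<Prod>i = 0..<p. M $$ (i, \<pi> i))"
  have "((\<lambda>t. ?d (M t)) \<longlongrightarrow> ?d (1\<^sub>m p)) F"
    by (intro tendsto_sum tendsto_mult tendsto_const tendsto_prod ent) (auto simp: permutes_in_image)
  moreover have "?d (1\<^sub>m p) = 1" using det_def'[OF one_carrier_mat, of p, where 'a = complex] by simp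
  ultimately have "((\<lambda>t. ?d (M t)) \<longlongrightarrow> 1) F" by (simp only:)
  hence "\<forall>\<^sub>F t in F. ?d (M t) \<noteq> 0" by (rule tendsto_imp_eventually_ne) simp
  thus ?thesis using M by eventually_elim (simp add: det_def')
qed

section \<open>Unitary factors and diagonal matrices of phases\<close>

lemma unitary_mat_iff:
  assumes "V \<in> carrier_mat p p"
  shows "unitary_mat V \<longleftrightarrow> mat_adjoint V * V = 1\<^sub>m p"
  using assms by (simp add: unitary_mat_def)

text \<open>A left factor with orthonormal columns does not change the Gram matrix; this moves Gram
  bounds from \<open>A = Q R\<close> to \<open>R\<close> and from \<open>S = W T\<close> to
  \<open>T\<close>.\<close>

lemma adjoint_mult_self:
  assumes "(A :: complex mat) \<in> carrier_mat m k" "B \<in> carrier_mat k p" "mat_adjoint A * A = 1\<^sub>m k"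
  shows "mat_adjoint (A * B) * (A * B) = mat_adjoint B * B"
proof -
  have "mat_adjoint (A * B) * (A * B) = mat_adjoint B * (mat_adjoint A * (A * B))"
    unfolding mat_adjoint_mult[OF assms(1,2)] using assms
    by (simp add: assoc_mult_mat[of "mat_adjoint B" p k "mat_adjoint A" m "A * B" p])
  also have "mat_adjoint A * (A * B) = B"
    using assms assoc_mult_mat[of "mat_adjoint A" k m A k B p] by simp
  finally show ?thesis .
qed

text \<open>The value 1 at zero, in place of \<open>sgn 0 = 0\<close>, keeps
  \<open>diagonal_phase\<close> unitary for every matrix.\<close>

definition phase :: "complex \<Rightarrow> complex" where
  "phase z = (if z = 0 then 1 else sgn z)"

lemma cmod_phase: "cmod (phase z) = 1"
  by (simp add: phase_def norm_sgn)

lemma cnj_phase_mult_phase: "cnj (phase z) * phase z = 1"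
proof -
  have "cnj w * w = (cmod w)\<^sup>2" for w by (simp only: complex_norm_square mult.commute)
  thus ?thesis by (simp add: cmod_phase)
qed

lemma minus_phase: "z - phase z = complex_of_real (cmod z - 1) * phase z"
  by (simp add: phase_def sgn_div_norm scaleR_conv_of_real field_simps)

definition diagonal_phase :: "nat \<Rightarrow> complex mat \<Rightarrow> complex mat" where
  "diagonal_phase p T = mat p p (\<lambda>(i, j). if i = j then phase (T $$ (i, i)) else 0)"

lemma diagonal_phase_carrier: "diagonal_phase p T \<in> carrier_mat p p"
  by (simp add: diagonal_phase_def)

lemma diagonal_phase_dim [simp]:
  "dim_row (diagonal_phase p T) = p" "dim_col (diagonal_phase p T) = p"
  by (simp_all add: diagonal_phase_def)

lemma diagonal_phase_unitary: "mat_adjoint (diagonal_phase p T) * diagonal_phase p T = 1\<^sub>m p"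
proof (rule eq_matI)
  fix i j assume "i < dim_row (1\<^sub>m p :: complex mat)" "j < dim_col (1\<^sub>m p :: complex mat)"
  hence ij: "i < p" "j < p" by auto
  have "(mat_adjoint (diagonal_phase p T) * diagonal_phase p T) $$ (i, j)
    = (\<Sum>k<p. cnj (diagonal_phase p T $$ (k, i)) * diagonal_phase p T $$ (k, j))"
    using ij by (simp add: scalar_prod_def atLeast0LessThan)
  also have "\<dots> = (\<Sum>k<p. if k = i then (if i = j then 1 else 0) else 0)"
    using ij by (intro sum.cong) (auto simp: diagonal_phase_def cnj_phase_mult_phase)
  also have "\<dots> = 1\<^sub>m p $$ (i, j)"
    using ij by simp
  finally show "(mat_adjoint (diagonal_phase p T) * diagonal_phase p T) $$ (i, j) = 1\<^sub>m p $$ (i, j)" .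
qed (auto simp: diagonal_phase_def)

text \<open>The difference vanishes below the diagonal and agrees with \<open>T\<close> above it. On
  the diagonal, \<open>z = cmod z * phase z\<close> reduces it to the distance of the modulus from
  1.\<close>

lemma upper_triangular_near_phase:
  assumes ev: "\<forall>\<^sub>F t in F. T t \<in> carrier_mat p p \<and> upper_triangular (T t)"
    and gram: "mat_bigo F p p g (\<lambda>t. mat_adjoint (T t) * T t - 1\<^sub>m p)"
    and g0: "(g \<longlongrightarrow> 0) F"
  shows "mat_bigo F p p g (\<lambda>t. T t - diagonal_phase p (T t))"
proof (rule mat_bigoI)
  note tri = upper_triangular_gram_bigo[OF ev gram g0]
  show "\<forall>\<^sub>F t in F. T t - diagonal_phase p (T t) \<in> carrier_mat p p"
    by (simp add: diagonal_phase_def minus_carrier_mat)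
  fix i j assume ij: "i < p" "j < p"
  have "\<forall>\<^sub>F t in F. (T t - diagonal_phase p (T t)) $$ (i, j) =
    (if i = j then complex_of_real (cmod (T t $$ (i, i)) - 1) * phase (T t $$ (i, i))
     else if i < j then T t $$ (i, j) else 0)"
    using ev by eventually_elim
      (use ij in \<open>auto simp: diagonal_phase_def minus_phase[symmetric, simplified] upper_triangular_def\<close>)
  moreover have "(\<lambda>t. if i = j then complex_of_real (cmod (T t $$ (i, i)) - 1) * phase (T t $$ (i, i))
     else if i < j then T t $$ (i, j) else 0) \<in> O[F](g)"
  proof (cases "i = j")
    case True
    have "(\<lambda>t. phase (T t $$ (i, i))) \<in> O[F](\<lambda>_. 1)"
      by (rule bigoI[of _ 1]) (simp add: cmod_phase)
    with True show ?thesis using mult_bigo_right[OF tri(2)[OF ij(1)]] by simp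
  next
    case False
    thus ?thesis using tri(1)[of i j] ij by (cases "i < j") auto
  qed
  ultimately show "(\<lambda>t. (T t - diagonal_phase p (T t)) $$ (i, j)) \<in> O[F](g)"
    using landau_o.big.in_cong by fastforce
qed

section \<open>Bounding the Grassmann distance\<close>

text \<open>Split \<open>Q = E S + P N\<close> along the range of \<open>E\<close> and its
  orthogonal complement. Here \<open>N R = P\<^sup>* A\<close>, so \<open>N\<close> is
  \<open>O(g)\<close>, and \<open>S\<^sup>* S = I - N\<^sup>* N\<close> is close to the identity. A
  QR factorisation \<open>S = W T\<close> has \<open>T\<close> close to a diagonal unitary \<Phi>,
  so \<open>Q\<close> is \<open>O(g)\<close>-close to \<open>E W \<Phi>\<close>, where
  \<open>W \<Phi>\<close> is unitary.\<close>

lemma grassmann_dist_bigo: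
  fixes A Q R E P :: "'a \<Rightarrow> complex mat"
  assumes QR: "\<forall>\<^sub>F t in F. Q t \<in> carrier_mat m p \<and> mat_adjoint (Q t) * Q t = 1\<^sub>m p \<and>
      R t \<in> carrier_mat p p \<and> upper_triangular (R t) \<and> A t = Q t * R t"
    and EP: "\<forall>\<^sub>F t in F. E t \<in> carrier_mat m p \<and> mat_adjoint (E t) * E t = 1\<^sub>m p \<and>
      P t \<in> carrier_mat m q \<and> mat_adjoint (P t) * P t = 1\<^sub>m q \<and>
      E t * mat_adjoint (E t) + P t * mat_adjoint (P t) = 1\<^sub>m m"
    and gram: "mat_bigo F p p h (\<lambda>t. mat_adjoint (A t) * A t - 1\<^sub>m p)" and h0: "(h \<longlongrightarrow> 0) F"
    and PA: "mat_bigo F q p g (\<lambda>t. mat_adjoint (P t) * A t)" and g0: "(g \<longlongrightarrow> 0) F"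
  shows "(\<lambda>t. grassmann_dist (Q t) (E t)) \<in> O[F](\<lambda>t. cmod (g t))"
proof -
  define N where "N t = mat_adjoint (P t) * Q t" for t
  define S where "S t = mat_adjoint (E t) * Q t" for t
  have cN: "\<forall>\<^sub>F t in F. N t \<in> carrier_mat q p"
    using QR EP unfolding N_def by eventually_elim auto
  have cS: "\<forall>\<^sub>F t in F. S t \<in> carrier_mat p p"
    using QR EP unfolding S_def by eventually_elim auto
  have "\<forall>\<^sub>F t in F. mat_adjoint (A t) * A t - 1\<^sub>m p = mat_adjoint (R t) * R t - 1\<^sub>m p"
    using QR by eventually_elim (auto simp: adjoint_mult_self)
  from mat_bigo_ev_eq[OF gram this] have gR: "mat_bigo F p p h (\<lambda>t. mat_adjoint (R t) * R t - 1\<^sub>m p)" .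
  have "\<forall>\<^sub>F t in F. mat_adjoint (P t) * A t = N t * R t"
    using QR EP by eventually_elim (auto simp: N_def intro!: assoc_mult_mat[symmetric])
  from mat_bigo_ev_eq[OF PA this] have NR: "mat_bigo F q p g (\<lambda>t. N t * R t)" .
  have "\<forall>\<^sub>F t in F. R t \<in> carrier_mat p p \<and> upper_triangular (R t)"
    using QR by eventually_elim simp
  from triangular_solve_bigo[OF cN this gR h0 NR] have N: "mat_bigo F q p g N" .
  have Qdec: "\<forall>\<^sub>F t in F. Q t = E t * S t + P t * N t"
    using QR EP
  proof eventually_elim
    case (elim t)
    have "Q t = (E t * mat_adjoint (E t) + P t * mat_adjoint (P t)) * Q t" using elim left_mult_one_mat[of "Q t" m p] by simp
    also have "\<dots> = E t * mat_adjoint (E t) * Q t + P t * mat_adjoint (P t) * Q t"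
      using elim by (intro add_mult_distrib_mat[of _ m m _ _ p]) auto
    also have "E t * mat_adjoint (E t) * Q t = E t * S t"
      unfolding S_def using elim by (intro assoc_mult_mat[of _ m p _ m _ p]) auto
    also have "P t * mat_adjoint (P t) * Q t = P t * N t"
      unfolding N_def using elim by (intro assoc_mult_mat[of _ m q _ m _ p]) auto
    finally show ?case .
  qed
  \<comment> \<open>This is \<open>Q\<^sup>* Q = I\<close> with the splitting of \<open>Q\<close>
    inserted.\<close>
  have SN: "\<forall>\<^sub>F t in F. - (mat_adjoint (N t) * N t) = mat_adjoint (S t) * S t - 1\<^sub>m p"
    using QR EP Qdec cS cN
  proof eventually_elim
    case (elim t)
    have "1\<^sub>m p = mat_adjoint (Q t) * (E t * S t + P t * N t)"
      using elim by simp
    also have "\<dots> = mat_adjoint (Q t) * (E t * S t) + mat_adjoint (Q t) * (P t * N t)"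
      using elim by (intro mult_add_distrib_mat[of _ p m _ p]) auto
    also have "mat_adjoint (Q t) * (E t * S t) = mat_adjoint (S t) * S t"
    proof -
      have "mat_adjoint (S t) = mat_adjoint (Q t) * E t"
        unfolding S_def using mat_adjoint_mult[of "mat_adjoint (E t)" p m "Q t" p] elim
        by (simp add: mat_adjoint_adjoint)
      thus ?thesis using assoc_mult_mat[of "mat_adjoint (Q t)" p m "E t" p "S t" p] elim by simp
    qed
    also have "mat_adjoint (Q t) * (P t * N t) = mat_adjoint (N t) * N t"
    proof -
      have "mat_adjoint (N t) = mat_adjoint (Q t) * P t"
        unfolding N_def using mat_adjoint_mult[of "mat_adjoint (P t)" q m "Q t" p] elim
        by (simp add: mat_adjoint_adjoint)
      thus ?thesis using assoc_mult_mat[of "mat_adjoint (Q t)" p m "P t" q "N t" p] elim by simp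
    qed
    finally have "1\<^sub>m p = mat_adjoint (S t) * S t + mat_adjoint (N t) * N t" .
    thus ?case using elim by (intro eq_matI) auto
  qed
  have "mat_bigo F p p (\<lambda>t. g t * g t) (\<lambda>t. mat_adjoint (N t) * N t)"
    by (rule mat_bigo_mult[OF mat_bigo_adjoint[OF N] N])
  \<comment> \<open>The Gram defect of \<open>S\<close> is of second order in \<open>g\<close>;
    since \<open>g\<close> tends to zero, first order may be claimed and is all that is
    used.\<close>
  moreover have "(\<lambda>t. g t * g t) \<in> O[F](g)"
    by (intro mult_bigo_right tendsto_zero_imp_bigo_1 g0 landau_o.big_refl)
  ultimately have gN: "mat_bigo F p p g (\<lambda>t. - (mat_adjoint (N t) * N t))"
    by (intro mat_bigo_uminus) (rule mat_bigo_trans)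
  from mat_bigo_ev_eq[OF gN SN] have gS: "mat_bigo F p p g (\<lambda>t. mat_adjoint (S t) * S t - 1\<^sub>m p)" .
  have cSS: "\<forall>\<^sub>F t in F. mat_adjoint (S t) * S t \<in> carrier_mat p p"
    using cS by eventually_elim auto
  have dS: "\<forall>\<^sub>F t in F. det (mat_adjoint (S t) * S t) \<noteq> 0"
    by (rule eventually_det_nonzero[OF cSS gS g0])
  \<comment> \<open>Placing the conditions on \<open>S t\<close> as premises under the existential
    allows \<open>W\<close> and \<open>T\<close> to be chosen as functions of every
    \<open>t\<close>.\<close>
  have "\<exists>W T. S t \<in> carrier_mat p p \<longrightarrow> det (mat_adjoint (S t) * S t) \<noteq> 0 \<longrightarrow>
      W \<in> carrier_mat p p \<and> T \<in> carrier_mat p p \<and> mat_adjoint W * W = 1\<^sub>m p \<and> upper_triangular T \<and> S t = W * T"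
    for t
  proof (cases "S t \<in> carrier_mat p p \<and> det (mat_adjoint (S t) * S t) \<noteq> 0")
    case True
    with qr_exists_aux[of "S t" p p] det_gram_nonzero_imp_inj_mat[of "S t" p p] show ?thesis by blast
  qed auto
  then obtain W T where WT: "\<And>t. S t \<in> carrier_mat p p \<longrightarrow> det (mat_adjoint (S t) * S t) \<noteq> 0 \<longrightarrow>
      W t \<in> carrier_mat p p \<and> T t \<in> carrier_mat p p \<and> mat_adjoint (W t) * W t = 1\<^sub>m p \<and>
      upper_triangular (T t) \<and> S t = W t * T t"
    by metis
  have WT: "\<forall>\<^sub>F t in F. W t \<in> carrier_mat p p \<and> T t \<in> carrier_mat p p \<and>
      mat_adjoint (W t) * W t = 1\<^sub>m p \<and> upper_triangular (T t) \<and> S t = W t * T t"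
    using cS dS by eventually_elim (use WT in blast)
  have "\<forall>\<^sub>F t in F. mat_adjoint (S t) * S t - 1\<^sub>m p = mat_adjoint (T t) * T t - 1\<^sub>m p"
    using WT by eventually_elim (auto simp: adjoint_mult_self)
  from mat_bigo_ev_eq[OF gS this] have gT: "mat_bigo F p p g (\<lambda>t. mat_adjoint (T t) * T t - 1\<^sub>m p)" .
  define \<Phi> where "\<Phi> t = diagonal_phase p (T t)" for t
  have cPhi: "\<Phi> t \<in> carrier_mat p p" for t by (simp add: \<Phi>_def diagonal_phase_carrier)
  have "\<forall>\<^sub>F t in F. T t \<in> carrier_mat p p \<and> upper_triangular (T t)"
    using WT by eventually_elim simp
  from upper_triangular_near_phase[OF this gT g0]
  have TP: "mat_bigo F p p g (\<lambda>t. T t - \<Phi> t)" unfolding \<Phi>_def .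
  have "\<forall>\<^sub>F t in F. E t \<in> carrier_mat m p \<and> mat_adjoint (E t) * E t = 1\<^sub>m p"
    using EP by eventually_elim simp
  hence bE: "mat_bigo F m p (\<lambda>_. 1) E" by (rule mat_bigo_orthonormal)
  have "\<forall>\<^sub>F t in F. P t \<in> carrier_mat m q \<and> mat_adjoint (P t) * P t = 1\<^sub>m q"
    using EP by eventually_elim simp
  hence bP: "mat_bigo F m q (\<lambda>_. 1) P" by (rule mat_bigo_orthonormal)
  have "\<forall>\<^sub>F t in F. W t \<in> carrier_mat p p \<and> mat_adjoint (W t) * W t = 1\<^sub>m p"
    using WT by eventually_elim simp
  hence bW: "mat_bigo F p p (\<lambda>_. 1) W" by (rule mat_bigo_orthonormal)
  have "mat_bigo F m p (\<lambda>t. 1 * (1 * g t)) (\<lambda>t. E t * (W t * (T t - \<Phi> t)))"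
    "mat_bigo F m p (\<lambda>t. 1 * g t) (\<lambda>t. P t * N t)"
    by (rule mat_bigo_mult bE bP bW TP N)+
  hence diff: "mat_bigo F m p g (\<lambda>t. E t * (W t * (T t - \<Phi> t)) + P t * N t)"
    by (intro mat_bigo_add) simp_all
  \<comment> \<open>The left side is the error \<open>E (S - W \<Phi>) + P N\<close>. The right side
    has the form \<open>X V - Y W\<close> that occurs in the distance, with the identity and
    \<open>W \<Phi>\<close> as the two unitary matrices.\<close>
  have ev: "\<forall>\<^sub>F t in F. E t * (W t * (T t - \<Phi> t)) + P t * N t = Q t * 1\<^sub>m p - E t * (W t * \<Phi> t)"
    using Qdec WT EP QR cN
  proof eventually_elim
    case (elim t)
    note c = cPhi[of t]
    have "E t * (W t * (T t - \<Phi> t)) = E t * (W t * T t) - E t * (W t * \<Phi> t)"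
      using elim c mult_minus_distrib_mat[of "W t" p p "T t" p "\<Phi> t"]
        mult_minus_distrib_mat[of "E t" m p "W t * T t" p "W t * \<Phi> t"]
      by (metis mult_carrier_mat)
    moreover have "Q t * 1\<^sub>m p = E t * (W t * T t) + P t * N t" using elim by simp
    ultimately show ?case using elim c by (intro eq_matI) auto
  qed
  from mat_bigo_ev_eq[OF diff ev] have "mat_bigo F m p g (\<lambda>t. Q t * 1\<^sub>m p - E t * (W t * \<Phi> t))" .
  from frobenius_norm_bigo[OF this]
  have fr: "(\<lambda>t. frobenius_norm (Q t * 1\<^sub>m p - E t * (W t * \<Phi> t))) \<in> O[F](\<lambda>t. cmod (g t))" .
  have "\<forall>\<^sub>F t in F. norm (grassmann_dist (Q t) (E t)) \<le> 1 * norm (frobenius_norm (Q t * 1\<^sub>m p - E t * (W t * \<Phi> t)))"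
    using QR EP WT
  proof eventually_elim
    case (elim t)
    have WP: "W t * \<Phi> t \<in> carrier_mat p p" using elim cPhi[of t] by auto
    moreover have "unitary_mat (W t * \<Phi> t)"
      unfolding unitary_mat_iff[OF WP] using elim cPhi[of t]
      by (subst adjoint_mult_self) (auto simp: \<Phi>_def diagonal_phase_unitary)
    moreover have "unitary_mat (1\<^sub>m p)"
      by (auto simp: unitary_mat_def mat_eq_iff scalar_prod_def intro!: sum.delta)
    moreover obtain V V' where "grassmann_dist (Q t) (E t) = frobenius_norm (Q t * V - E t * V')"
      "\<And>V' W'. \<lbrakk>V' \<in> carrier_mat p p; unitary_mat V'; W' \<in> carrier_mat p p; unitary_mat W'\<rbrakk> \<Longrightarrow>
       grassmann_dist (Q t) (E t) \<le> frobenius_norm (Q t * V' - E t * W')"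
      using grassmann_dist_attained[of "Q t" m p "E t"] elim by metis
    moreover have "0 \<le> frobenius_norm X" for X by (simp add: frobenius_norm_def sum_nonneg)
    ultimately show ?case by simp
  qed
  hence "(\<lambda>t. grassmann_dist (Q t) (E t)) \<in> O[F](\<lambda>t. frobenius_norm (Q t * 1\<^sub>m p - E t * (W t * \<Phi> t)))"
    by (rule bigoI)
  thus ?thesis using fr by (rule landau_o.big_trans)
qed

section \<open>The Pade coefficients\<close>

lemma coeff_one_plus_X_power: "coeff ([:1, 1 :: real:] ^ k) i = real (k choose i)"
proof (cases "i \<le> k")
  case False
  thus ?thesis using degree_linear_power[of "1 :: real" k] by (simp add: coeff_eq_0)
qed (simp add: coeff_linear_poly_power)

text \<open>Write \<open>1 - x = - 2 x + (1 + x)\<close> and expand its \<open>n\<close>-th power.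
  The factor \<open>(1 + x)^n\<close> then merges with the remaining powers into
  \<open>(1 + x)^(2 * n - j)\<close>.\<close>

lemma coeff_pade_poly:
  "coeff ([:1, 1:] ^ n * [:1, - 1:] ^ n :: real poly) s =
     (\<Sum>j\<le>s. real (n choose j) * real ((2 * n - j) choose (s - j)) * (- 2) ^ j)"
proof -
  have m2: "[:0, - 2 :: real:] ^ j = monom ((- 2) ^ j) j" for j
  proof -
    have "[:0, - 2 :: real:] = monom (- 2) 1" by (simp add: monom_Suc monom_0)
    thus ?thesis by (simp add: monom_power)
  qed
  have "[:1, - 1 :: real:] = [:0, - 2:] + [:1, 1:]" by simp
  hence "[:1, - 1 :: real:] ^ n = (\<Sum>j\<le>n. of_nat (n choose j) * [:0, - 2:] ^ j * [:1, 1:] ^ (n - j))"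
    by (simp only: binomial_ring)
  hence "[:1, 1:] ^ n * [:1, - 1 :: real:] ^ n =
      (\<Sum>j\<le>n. of_nat (n choose j) * ([:0, - 2:] ^ j * ([:1, 1:] ^ n * [:1, 1:] ^ (n - j))))"
    by (simp add: sum_distrib_left mult_ac)
  also have "\<dots> = (\<Sum>j\<le>n. smult (real (n choose j)) (monom ((- 2) ^ j) j * [:1, 1:] ^ (2 * n - j)))"
    by (intro sum.cong) (simp_all add: m2 of_nat_poly mult_2 flip: power_add)
  finally have "coeff ([:1, 1:] ^ n * [:1, - 1 :: real:] ^ n) s =
      (\<Sum>j\<le>n. if j \<le> s then real (n choose j) * real ((2 * n - j) choose (s - j)) * (- 2) ^ j else 0)"
    by (simp add: coeff_sum coeff_monom_mult coeff_one_plus_X_power if_distrib not_less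
        mult_ac cong: if_cong sum.cong) 
  also have "\<dots> = (\<Sum>j\<in>{..n} \<inter> {..s}. real (n choose j) * real ((2 * n - j) choose (s - j)) * (- 2) ^ j)"
    by (subst sum.inter_restrict) auto
  \<comment> \<open>The indices with \<open>n < j \<le> s\<close> may be added because
    \<open>n choose j\<close> vanishes there.\<close>
  also have "\<dots> = (\<Sum>j\<le>s. real (n choose j) * real ((2 * n - j) choose (s - j)) * (- 2) ^ j)"
    by (intro sum.mono_neutral_left) auto
  finally show ?thesis .
qed

text \<open>The polynomial is \<open>(1 - x\<^sup>2)^n\<close>, which is invariant under the
  substitution of \<open>- x\<close> for \<open>x\<close>.\<close>

lemma coeff_pade_poly_odd:
  assumes "odd s"
  shows "coeff ([:1, 1:] ^ n * [:1, - 1:] ^ n :: real poly) s = 0"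
proof -
  let ?P = "[:1, 1:] ^ n * [:1, - 1:] ^ n :: real poly"
  have "?P \<circ>\<^sub>p [:0, - 1:] = ?P"
    by (rule poly_ext) (simp add: poly_pcompose mult.commute)
  hence "(- 1) ^ s * coeff ?P s = coeff ?P s"
    using coeff_pcompose_linear[of ?P "- 1" s] by simp
  thus ?thesis using assms by simp
qed

text \<open>The Cauchy product of \<open>\<Sum> a\<^sub>k z\<^sup>k\<close> and \<open>exp (- z)\<close> has coefficient
  \<open>(- 1)\<^sup>s (2n - s)! / (2n)! \<cdot> [x\<^sup>s] (1 + x)\<^sup>n (1 - x)\<^sup>n\<close> at \<open>z\<^sup>s\<close>,
  and the latter polynomial is even in \<open>x\<close>.\<close>

lemma pade_coeff_convolution_odd:
  assumes s: "odd s" "s \<le> 2 * n"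
  shows "(\<Sum>j\<le>s. pade_coeff n j * ((- 1) ^ (s - j) / fact (s - j))) = 0"
proof -
  have "pade_coeff n j * ((- 1) ^ (s - j) / fact (s - j)) =
    (- 1) ^ s * (fact (2 * n - s) / fact (2 * n)) *
    (real (n choose j) * real ((2 * n - j) choose (s - j)) * (- 2) ^ j)" if j: "j \<le> s" for j
  proof -
    \<comment> \<open>Here \<open>s \<le> 2 * n\<close> is essential. The factor
      \<open>(2 * n - j)!\<close> of the Pade coefficient and \<open>1 / (s - j)!\<close> of the
      exponential combine into a binomial coefficient, at the cost of \<open>(2 * n - s)!\<close>,
      which is free of \<open>j\<close>.\<close>
    have "real ((2 * n - j) choose (s - j)) = fact (2 * n - j) / (fact (s - j) * fact (2 * n - s))"
      using j s by (subst binomial_fact) auto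
    moreover have "(- 1 :: real) ^ (s - j) * 2 ^ j = (- 1) ^ s * (- 2) ^ j"
    proof -
      have "(- 1 :: real) ^ s * (- 2) ^ j = (- 1) ^ (s - j) * ((- 1) ^ j * (- 2) ^ j)"
        using j by (simp flip: power_add mult.assoc)
      thus ?thesis by (simp flip: power_mult_distrib)
    qed
    moreover have "pade_coeff n j * ((- 1) ^ (s - j) / fact (s - j)) =
        real (n choose j) * (fact (2 * n - j) / fact (2 * n)) * ((- 1) ^ (s - j) * 2 ^ j) / fact (s - j)"
      by (simp add: pade_coeff_def)
    ultimately show ?thesis by simp
  qed
  hence "(\<Sum>j\<le>s. pade_coeff n j * ((- 1) ^ (s - j) / fact (s - j))) =
    (- 1) ^ s * (fact (2 * n - s) / fact (2 * n)) * coeff ([:1, 1:] ^ n * [:1, - 1:] ^ n :: real poly) s"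
    unfolding coeff_pade_poly sum_distrib_left by (intro sum.cong) auto
  thus ?thesis using coeff_pade_poly_odd[OF s(1)] by simp
qed

lemma pade_coeff_0: "pade_coeff n 0 = 1"
  by (simp add: pade_coeff_def)

lemma pade_coeff_eq_0: "n < k \<Longrightarrow> pade_coeff n k = 0"
  by (simp add: pade_coeff_def)

section \<open>Matrix exponentials\<close>

lemma pow_mat_add:
  assumes A: "(A :: 'a :: semiring_1 mat) \<in> carrier_mat d d"
  shows "A ^\<^sub>m (j + k) = A ^\<^sub>m j * A ^\<^sub>m k"
proof (induction k)
  case (Suc k)
  thus ?case using A assoc_mult_mat[of "A ^\<^sub>m j" d d "A ^\<^sub>m k" d A d] by (simp add: pow_carrier_mat)
qed (use A in auto)

lemma smult_pow_mat:
  assumes A: "(A :: 'a :: comm_semiring_1 mat) \<in> carrier_mat d d"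
  shows "(c \<cdot>\<^sub>m A) ^\<^sub>m k = c ^ k \<cdot>\<^sub>m (A ^\<^sub>m k)"
proof (induction k)
  case (Suc k)
  have "A ^\<^sub>m k \<in> carrier_mat d d" using A by (simp add: pow_carrier_mat)
  thus ?case unfolding pow_mat.simps Suc using A
    by (simp add: mult_smult_assoc_mat[of _ d d] mult_smult_distrib[of _ d d]) (auto intro!: eq_matI simp: mult_ac)
qed (use A in \<open>auto intro!: eq_matI\<close>)

lemma mat_adjoint_one [simp]: "mat_adjoint (1\<^sub>m d :: complex mat) = 1\<^sub>m d"
  by (intro eq_matI) auto

lemma mat_adjoint_pow:
  assumes A: "(A :: complex mat) \<in> carrier_mat d d"
  shows "mat_adjoint (A ^\<^sub>m k) = mat_adjoint A ^\<^sub>m k"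
proof (induction k)
  case (Suc k)
  have c: "A ^\<^sub>m k \<in> carrier_mat d d" using A by (simp add: pow_carrier_mat)
  \<comment> \<open>The adjoint reverses the product. Writing the single factor as a first power
    lets \<open>pow_mat_add\<close> restore the order.\<close>
  have "mat_adjoint (A ^\<^sub>m Suc k) = mat_adjoint A ^\<^sub>m 1 * mat_adjoint A ^\<^sub>m k"
    using mat_adjoint_mult[OF c A] A Suc by simp
  also have "\<dots> = mat_adjoint A ^\<^sub>m (1 + k)"
    by (rule pow_mat_add[symmetric]) (use A in auto)
  finally show ?case by simp
qed (use A in auto)

section \<open>Entrywise power series and the one-parameter group\<close>

lemma mat_exp_entry_sums:
  assumes A: "(A :: complex mat) \<in> carrier_mat d d" and ij: "i < d" "j < d"
  shows "(\<lambda>k. c ^ k * (A ^\<^sub>m k) $$ (i, j) / fact k) sums (mat_exp (c \<cdot>\<^sub>m A) $$ (i, j))"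
proof -
  have cA: "c \<cdot>\<^sub>m A \<in> carrier_mat d d" using A by simp
  have "(\<lambda>k. ((c \<cdot>\<^sub>m A) ^\<^sub>m k) $$ (i, j) / fact k) sums (mat_exp (c \<cdot>\<^sub>m A) $$ (i, j))"
    using summable_sums[OF mat_exp_summable[OF cA ij]] A ij by (simp add: mat_exp_def)
  thus ?thesis using A ij by (simp add: smult_pow_mat pow_mat_dim_square[OF A])
qed

text \<open>The shift \<open>r\<close> covers the series of the exponential multiplied by the power
  \<open>A ^\<^sub>m r\<close>.\<close>

lemma summable_norm_pow_mat_fact:
  assumes A: "(A :: complex mat) \<in> carrier_mat d d" and ij: "i < d" "j < d"
  shows "summable (\<lambda>k. norm ((A ^\<^sub>m (k + r)) $$ (i, j) / fact k))"
proof (rule summable_comparison_test')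
  let ?c = "\<Sum>r<d. \<Sum>c<d. norm (A $$ (r, c))"
  show "summable (\<lambda>k. ?c ^ r * (inverse (fact k) * ?c ^ k))"
    by (intro summable_mult summable_exp)
  show "norm (norm ((A ^\<^sub>m (k + r)) $$ (i, j) / fact k)) \<le> ?c ^ r * (inverse (fact k) * ?c ^ k)" for k
    using divide_right_mono[OF pow_mat_entry_bound[OF assms, of "k + r"], of "fact k"]
    by (simp add: norm_divide power_add field_simps)
qed

text \<open>The entry series converge absolutely, so their Cauchy products may be formed. Both
  exponents are multiples of one matrix, hence the coefficients collapse by the scalar binomial
  theorem.\<close>

lemma mat_exp_smult_add:
  assumes A: "(A :: complex mat) \<in> carrier_mat d d"
  shows "mat_exp (a \<cdot>\<^sub>m A) * mat_exp (b \<cdot>\<^sub>m A) = mat_exp ((a + b) \<cdot>\<^sub>m A)"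
proof (rule eq_matI)
  fix i j assume "i < dim_row (mat_exp ((a + b) \<cdot>\<^sub>m A))" "j < dim_col (mat_exp ((a + b) \<cdot>\<^sub>m A))"
  hence ij: "i < d" "j < d" using A by (auto simp: mat_exp_def)
  have cE: "mat_exp (c \<cdot>\<^sub>m A) \<in> carrier_mat d d" for c using A by simp
  define u where "u c x y k = c ^ k * (A ^\<^sub>m k) $$ (x, y) / fact k" for c x y k
  have u: "u c x y sums (mat_exp (c \<cdot>\<^sub>m A) $$ (x, y))" if "x < d" "y < d" for c x y
    unfolding u_def by (rule mat_exp_entry_sums[OF A that])
  have un: "summable (\<lambda>k. norm (u c x y k))" if "x < d" "y < d" for c x y
    using summable_norm_pow_mat_fact[of "c \<cdot>\<^sub>m A" d x y 0] A that
    by (simp add: u_def smult_pow_mat pow_mat_dim_square[OF A])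
  have "(\<lambda>k. \<Sum>r\<le>k. u a i l r * u b l j (k - r)) sums (mat_exp (a \<cdot>\<^sub>m A) $$ (i, l) * mat_exp (b \<cdot>\<^sub>m A) $$ (l, j))"
    if "l < d" for l
    using Cauchy_product_sums[OF un un, of i l l j a b] that ij u by (simp add: sums_iff)
  hence "(\<lambda>k. \<Sum>l<d. \<Sum>r\<le>k. u a i l r * u b l j (k - r)) sums
      (\<Sum>l<d. mat_exp (a \<cdot>\<^sub>m A) $$ (i, l) * mat_exp (b \<cdot>\<^sub>m A) $$ (l, j))"
    by (intro sums_sum) auto
  also have "(\<lambda>k. \<Sum>l<d. \<Sum>r\<le>k. u a i l r * u b l j (k - r)) = u (a + b) i j"
  proof
    fix k
    have "(\<Sum>l<d. \<Sum>r\<le>k. u a i l r * u b l j (k - r)) = (\<Sum>r\<le>k. \<Sum>l<d. u a i l r * u b l j (k - r))"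
      by (rule sum.swap)
    also have "\<dots> = (\<Sum>r\<le>k. of_nat (k choose r) * a ^ r * b ^ (k - r) * (A ^\<^sub>m k) $$ (i, j) / fact k)"
    proof (rule sum.cong)
      fix r assume "r \<in> {..k}"
      hence r: "r \<le> k" by simp
      have "(A ^\<^sub>m k) $$ (i, j) = (\<Sum>l<d. (A ^\<^sub>m r) $$ (i, l) * (A ^\<^sub>m (k - r)) $$ (l, j))"
        using pow_mat_add[OF A, of r "k - r"] r ij A
        by (auto simp: scalar_prod_def atLeast0LessThan pow_mat_dim_square[OF A])
      moreover have "of_nat (k choose r) / fact k = 1 / (fact r * fact (k - r) :: complex)"
        using binomial_fact[OF r, where 'a = complex] by (simp add: field_simps)
      ultimately have "of_nat (k choose r) * a ^ r * b ^ (k - r) * (A ^\<^sub>m k) $$ (i, j) / fact k =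
         a ^ r * b ^ (k - r) / (fact r * fact (k - r)) * (\<Sum>l<d. (A ^\<^sub>m r) $$ (i, l) * (A ^\<^sub>m (k - r)) $$ (l, j))"
        by (simp add: field_simps)
      thus "(\<Sum>l<d. u a i l r * u b l j (k - r)) =
          of_nat (k choose r) * a ^ r * b ^ (k - r) * (A ^\<^sub>m k) $$ (i, j) / fact k"
        by (simp add: u_def sum_distrib_left mult_ac)
    qed simp
    also have "\<dots> = (a + b) ^ k * (A ^\<^sub>m k) $$ (i, j) / fact k"
      by (simp add: binomial_ring sum_distrib_right sum_divide_distrib)
    finally show "(\<Sum>l<d. \<Sum>r\<le>k. u a i l r * u b l j (k - r)) = u (a + b) i j k"
      by (simp add: u_def)
  qed
  finally have "(\<Sum>l<d. mat_exp (a \<cdot>\<^sub>m A) $$ (i, l) * mat_exp (b \<cdot>\<^sub>m A) $$ (l, j)) = mat_exp ((a + b) \<cdot>\<^sub>m A) $$ (i, j)"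
    using u[OF ij] sums_unique2 by blast
  thus "(mat_exp (a \<cdot>\<^sub>m A) * mat_exp (b \<cdot>\<^sub>m A)) $$ (i, j) = mat_exp ((a + b) \<cdot>\<^sub>m A) $$ (i, j)"
    using cE[of a] cE[of b] ij by (auto simp: scalar_prod_def atLeast0LessThan)
qed (use A in \<open>auto simp: mat_exp_def\<close>)

lemma mat_exp_smult_0:
  assumes A: "(A :: complex mat) \<in> carrier_mat d d"
  shows "mat_exp (0 \<cdot>\<^sub>m A) = 1\<^sub>m d"
proof (rule eq_matI)
  fix i j assume "i < dim_row (1\<^sub>m d :: complex mat)" "j < dim_col (1\<^sub>m d :: complex mat)"
  hence ij: "i < d" "j < d" by auto
  have "(\<lambda>k. 0 ^ k * (A ^\<^sub>m k) $$ (i, j) / fact k) sums (\<Sum>k\<in>{0}. 0 ^ k * (A ^\<^sub>m k) $$ (i, j) / fact k)"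
    by (rule sums_finite) auto
  with mat_exp_entry_sums[OF A ij, of 0] show "mat_exp (0 \<cdot>\<^sub>m A) $$ (i, j) = 1\<^sub>m d $$ (i, j)"
    using sums_unique2 A by fastforce
qed (use A in \<open>auto simp: mat_exp_def\<close>)

text \<open>Conjugation fixes the real number \<open>t\<close>, and skewness makes the adjoint of
  \<open>A ^\<^sub>m k\<close> equal to \<open>(- 1) ^ k\<close> times that power; the two series
  agree term by term.\<close>

lemma mat_exp_skew_adjoint:
  assumes A: "(A :: complex mat) \<in> carrier_mat d d" and sk: "mat_adjoint A = - A"
  shows "mat_adjoint (mat_exp (complex_of_real t \<cdot>\<^sub>m A)) = mat_exp (- complex_of_real t \<cdot>\<^sub>m A)"
proof (rule eq_matI)
  fix i j assume "i < dim_row (mat_exp (- complex_of_real t \<cdot>\<^sub>m A))" "j < dim_col (mat_exp (- complex_of_real t \<cdot>\<^sub>m A))"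
  hence ij: "i < d" "j < d" using A by (auto simp: mat_exp_def)
  have "- A = - 1 \<cdot>\<^sub>m A" using A by (intro eq_matI) auto
  hence "mat_adjoint (A ^\<^sub>m k) = (- 1) ^ k \<cdot>\<^sub>m A ^\<^sub>m k" for k
    using A sk by (simp add: mat_adjoint_pow smult_pow_mat)
  hence e: "cnj ((A ^\<^sub>m k) $$ (j, i)) = (- 1) ^ k * (A ^\<^sub>m k) $$ (i, j)" for k
    using mat_adjoint_index[of i "A ^\<^sub>m k" j] A ij by (simp add: pow_mat_dim_square[OF A])
  have "(\<lambda>k. cnj (complex_of_real t ^ k * (A ^\<^sub>m k) $$ (j, i) / fact k)) sums
      cnj (mat_exp (complex_of_real t \<cdot>\<^sub>m A) $$ (j, i))"
    unfolding sums_cnj by (rule mat_exp_entry_sums[OF A ij(2,1)])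
  moreover have "cnj (complex_of_real t ^ k * (A ^\<^sub>m k) $$ (j, i) / fact k)
      = (- complex_of_real t) ^ k * (A ^\<^sub>m k) $$ (i, j) / fact k" for k
    using power_mult_distrib[of "- 1" "complex_of_real t" k] by (simp add: e)
  ultimately have "cnj (mat_exp (complex_of_real t \<cdot>\<^sub>m A) $$ (j, i)) = mat_exp (- complex_of_real t \<cdot>\<^sub>m A) $$ (i, j)"
    using mat_exp_entry_sums[OF A ij, of "- complex_of_real t"] sums_unique2 by fastforce
  thus "mat_adjoint (mat_exp (complex_of_real t \<cdot>\<^sub>m A)) $$ (i, j) = mat_exp (- complex_of_real t \<cdot>\<^sub>m A) $$ (i, j)"
    using A ij by (simp add: mat_exp_def)
qed (use A in \<open>auto simp: mat_exp_def\<close>)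

section \<open>Taylor remainders and the Pade cancellation\<close>

lemma power_series_remainder_bigo:
  fixes b :: "nat \<Rightarrow> complex"
  assumes b: "summable (\<lambda>k. norm (b k))"
  shows "(\<lambda>t::real. (\<Sum>k. b k * complex_of_real t ^ k) - (\<Sum>k<N. b k * complex_of_real t ^ k))
    \<in> O[at 0](\<lambda>t. complex_of_real t ^ N)"
proof (rule bigoI)
  have "\<forall>\<^sub>F t in at (0::real). \<bar>t\<bar> < 1"
    by (rule eventually_at_leftI eventually_at[THEN iffD2], rule exI[of _ 1]) auto
  thus "\<forall>\<^sub>F t in at (0::real). norm ((\<Sum>k. b k * complex_of_real t ^ k) - (\<Sum>k<N. b k * complex_of_real t ^ k))
      \<le> (\<Sum>k. norm (b (k + N))) * norm (complex_of_real t ^ N)"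
  proof eventually_elim
    case (elim t)
    have tk: "\<bar>t\<bar> ^ k \<le> 1" for k using elim by (simp add: power_le_one)
    have le: "norm (b k * complex_of_real t ^ k) \<le> norm (b k)" for k
      using tk[of k] by (simp add: norm_mult norm_power mult_left_le)
    have sm: "summable (\<lambda>k. b k * complex_of_real t ^ k)"
      by (rule summable_comparison_test'[OF b]) (rule le)
    have bN: "summable (\<lambda>k. norm (b (k + N)))" using b by (rule summable_ignore_initial_segment)
    \<comment> \<open>For \<open>\<bar>t\<bar> < 1\<close> the power
      \<open>\<bar>t\<bar> ^ k\<close> is at most 1, so \<open>\<bar>t\<bar> ^ N\<close> factors out
      and leaves the tail of the norms as the constant.\<close>
    have leN: "norm (b (k + N) * complex_of_real t ^ (k + N)) \<le> norm (b (k + N)) * \<bar>t\<bar> ^ N" for k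
      using mult_left_mono[OF mult_right_mono[OF tk[of k], of "\<bar>t\<bar> ^ N"], of "norm (b (k + N))"]
      by (simp add: norm_mult norm_power power_add mult_ac)
    have "(\<Sum>k. b k * complex_of_real t ^ k) - (\<Sum>k<N. b k * complex_of_real t ^ k) =
        (\<Sum>k. b (k + N) * complex_of_real t ^ (k + N))"
      using suminf_minus_initial_segment[OF sm, of N] by simp
    also have "norm \<dots> \<le> (\<Sum>k. norm (b (k + N)) * \<bar>t\<bar> ^ N)"
      by (rule norm_suminf_le) (use leN bN in \<open>auto intro: summable_mult2\<close>)
    also have "\<dots> = (\<Sum>k. norm (b (k + N))) * \<bar>t\<bar> ^ N"
      using bN by (rule suminf_mult2[symmetric])
    finally show ?case by (simp add: norm_power)
  qed
qed

lemma mat_exp_mult_pow_entry_sums: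
  assumes B: "(B :: complex mat) \<in> carrier_mat d d" and rl: "r < d" "l < d"
  shows "(\<lambda>k. c ^ k * (B ^\<^sub>m (k + j)) $$ (r, l) / fact k) sums ((mat_exp (c \<cdot>\<^sub>m B) * B ^\<^sub>m j) $$ (r, l))"
proof -
  have "(\<lambda>k. \<Sum>x<d. c ^ k * (B ^\<^sub>m k) $$ (r, x) / fact k * (B ^\<^sub>m j) $$ (x, l)) sums
      (\<Sum>x<d. mat_exp (c \<cdot>\<^sub>m B) $$ (r, x) * (B ^\<^sub>m j) $$ (x, l))"
    by (intro sums_sum sums_mult2 mat_exp_entry_sums[OF B rl(1)]) auto
  also have "(\<lambda>k. \<Sum>x<d. c ^ k * (B ^\<^sub>m k) $$ (r, x) / fact k * (B ^\<^sub>m j) $$ (x, l)) =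
      (\<lambda>k. c ^ k * (B ^\<^sub>m (k + j)) $$ (r, l) / fact k)"
  proof
    fix k
    have "(B ^\<^sub>m (k + j)) $$ (r, l) = (\<Sum>x<d. (B ^\<^sub>m k) $$ (r, x) * (B ^\<^sub>m j) $$ (x, l))"
      using pow_mat_add[OF B, of k j] rl B
      by (auto simp: scalar_prod_def atLeast0LessThan pow_mat_dim_square[OF B])
    thus "(\<Sum>x<d. c ^ k * (B ^\<^sub>m k) $$ (r, x) / fact k * (B ^\<^sub>m j) $$ (x, l)) =
      c ^ k * (B ^\<^sub>m (k + j)) $$ (r, l) / fact k"
      by (simp add: sum_distrib_left sum_divide_distrib mult_ac)
  qed
  also have "(\<Sum>x<d. mat_exp (c \<cdot>\<^sub>m B) $$ (r, x) * (B ^\<^sub>m j) $$ (x, l)) = (mat_exp (c \<cdot>\<^sub>m B) * B ^\<^sub>m j) $$ (r, l)"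
    using rl B by (simp add: mat_exp_def scalar_prod_def atLeast0LessThan pow_mat_dim_square[OF B])
  finally show ?thesis .
qed

text \<open>The sum is an entry of \<open>exp (- t B) \<theta>(t B)\<close>. Its coefficient at
  \<open>t ^ s\<close> is the entry of \<open>B ^\<^sub>m s\<close> times the convolution of the
  Pade coefficients with the series of \<open>exp (- z)\<close>. For even \<open>s\<close> the first
  factor vanishes, for odd \<open>s \<le> 2 * n\<close> the second one does.\<close>

lemma exp_pade_entry_bigo:
  assumes B: "(B :: complex mat) \<in> carrier_mat d d" and rl: "r < d" "l < d"
    and even: "\<And>s. even s \<Longrightarrow> (B ^\<^sub>m s) $$ (r, l) = 0"
  shows "(\<lambda>t::real. \<Sum>j\<le>n. complex_of_real (pade_coeff n j) * complex_of_real t ^ j *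
      (mat_exp (- complex_of_real t \<cdot>\<^sub>m B) * B ^\<^sub>m j) $$ (r, l)) \<in> O[at 0](\<lambda>t. complex_of_real t ^ (2 * n + 1))"
proof -
  let ?a = "\<lambda>j. complex_of_real (pade_coeff n j)"
  define b where "b j k = (- 1) ^ k * (B ^\<^sub>m (k + j)) $$ (r, l) / fact k" for j k
  define f where "f j t = (mat_exp (- complex_of_real t \<cdot>\<^sub>m B) * B ^\<^sub>m j) $$ (r, l)" for j t
  have f: "f j t = (\<Sum>k. b j k * complex_of_real t ^ k)" for j t
    using mat_exp_mult_pow_entry_sums[OF B rl, of "- complex_of_real t" j]
      power_mult_distrib[of "- 1" "complex_of_real t"]
    unfolding f_def b_def by (simp add: sums_iff mult_ac)
  have sb: "summable (\<lambda>k. norm (b j k))" for j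
    using summable_norm_pow_mat_fact[OF B rl, of j] by (simp add: b_def norm_mult norm_divide norm_power)
  \<comment> \<open>Cutting the \<open>j\<close>-th series before degree
    \<open>2 * n + 1 - j\<close> means that, after the factor \<open>t ^ j\<close>, exactly the
    total degrees up to \<open>2 * n\<close> are kept.\<close>
  define g where "g j t = (\<Sum>k<2 * n + 1 - j. b j k * complex_of_real t ^ k)" for j t
  have rem: "(\<lambda>t. ?a j * (complex_of_real t ^ j * (f j t - g j t))) \<in> O[at 0](\<lambda>t. complex_of_real t ^ (2 * n + 1))"
    if j: "j \<le> 2 * n" for j
  proof -
    have "(\<lambda>t. complex_of_real t ^ j * (f j t - g j t)) \<in>
        O[at 0](\<lambda>t. complex_of_real t ^ j * complex_of_real t ^ (2 * n + 1 - j))"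
      unfolding f g_def by (intro landau_o.big.mult power_series_remainder_bigo sb landau_o.big_refl)
    also have "(\<lambda>t. complex_of_real t ^ j * complex_of_real t ^ (2 * n + 1 - j)) = (\<lambda>t. complex_of_real t ^ (2 * n + 1))"
      using j by (simp flip: power_add)
    finally show ?thesis by simp
  qed
  \<comment> \<open>Summing to \<open>2 * n\<close> instead of \<open>n\<close> adds only zero Pade
    coefficients and makes the index set the full triangle \<open>j + k \<le> 2 * n\<close>, which
    is then summed along its diagonals.\<close>
  have cancel: "(\<Sum>j\<le>2 * n. ?a j * (complex_of_real t ^ j * g j t)) = 0" for t
  proof -
    define w where "w j k = ?a j * b j k * complex_of_real t ^ (j + k)" for j k
    have "(\<Sum>j\<le>2 * n. ?a j * (complex_of_real t ^ j * g j t)) = (\<Sum>j\<le>2 * n. \<Sum>k\<le>2 * n - j. w j k)"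
    proof (rule sum.cong)
      fix j assume "j \<in> {..2 * n}"
      hence "{..<2 * n + 1 - j} = {..2 * n - j}" by auto
      thus "?a j * (complex_of_real t ^ j * g j t) = (\<Sum>k\<le>2 * n - j. w j k)"
        by (simp add: g_def w_def sum_distrib_left power_add mult_ac)
    qed simp
    also have "\<dots> = (\<Sum>(j, k)\<in>{(j, k). j + k \<le> 2 * n}. w j k)"
      by (subst sum.Sigma) (auto intro!: sum.cong)
    also have "\<dots> = (\<Sum>s\<le>2 * n. \<Sum>j\<le>s. w j (s - j))"
      by (rule sum.triangle_reindex_eq)
    also have "\<dots> = (\<Sum>s\<le>2 * n. complex_of_real t ^ s * (B ^\<^sub>m s) $$ (r, l) *
        complex_of_real (\<Sum>j\<le>s. pade_coeff n j * ((- 1) ^ (s - j) / fact (s - j))))"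
      by (intro sum.cong refl) (simp add: w_def b_def sum_distrib_left mult_ac)
    also have "\<dots> = 0"
    proof (rule sum.neutral, rule ballI)
      fix s assume "s \<in> {..2 * n}"
      thus "complex_of_real t ^ s * (B ^\<^sub>m s) $$ (r, l) *
        complex_of_real (\<Sum>j\<le>s. pade_coeff n j * ((- 1) ^ (s - j) / fact (s - j))) = 0"
        using even[of s] pade_coeff_convolution_odd[of s n] by (cases "even s") auto
    qed
    finally show ?thesis .
  qed
  have "(\<lambda>t. \<Sum>j\<le>2 * n. ?a j * (complex_of_real t ^ j * (f j t - g j t))) \<in> O[at 0](\<lambda>t. complex_of_real t ^ (2 * n + 1))"
    by (intro big_sum_in_bigo rem) auto
  also have "(\<lambda>t. \<Sum>j\<le>2 * n. ?a j * (complex_of_real t ^ j * (f j t - g j t))) =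
      (\<lambda>t. (\<Sum>j\<le>2 * n. ?a j * (complex_of_real t ^ j * f j t)) - (\<Sum>j\<le>2 * n. ?a j * (complex_of_real t ^ j * g j t)))"
    by (simp add: sum_subtractf right_diff_distrib)
  also have "\<dots> = (\<lambda>t. \<Sum>j\<le>n. ?a j * (complex_of_real t ^ j * f j t))"
    unfolding cancel diff_0_right
    by (intro ext sum.mono_neutral_right) (auto simp: pade_coeff_eq_0)
  finally show ?thesis by (simp add: f_def mult_ac)
qed

text \<open>\<open>B\<close> exchanges the coordinates below \<open>p\<close> with the others. So
  odd powers vanish inside the diagonal blocks and even powers vanish outside them.\<close>

lemma pow_mat_parity:
  assumes B: "(B :: 'a :: semiring_1 mat) \<in> carrier_mat d d"
    and par: "\<And>r l. r < d \<Longrightarrow> l < d \<Longrightarrow> (r < p \<longleftrightarrow> l < p) \<Longrightarrow> B $$ (r, l) = 0"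
    and rl: "r < d" "l < d" "(r < p \<longleftrightarrow> l < p) \<longleftrightarrow> odd s"
  shows "(B ^\<^sub>m s) $$ (r, l) = 0"
  using rl
proof (induction s arbitrary: l)
  case (Suc s)
  have "(B ^\<^sub>m s) $$ (r, k) * B $$ (k, l) = 0" if "k < d" for k
    using Suc.IH[of k] Suc.prems par[of k l] that by (cases "k < p \<longleftrightarrow> l < p"; cases "even s"; cases "r < p") simp_all
  thus ?case using B Suc.prems
    by (auto simp: scalar_prod_def pow_mat_dim_square[OF B] intro!: sum.neutral)
qed (use B in auto)

section \<open>The block matrix of a tangent vector\<close>

definition first_cols :: "nat \<Rightarrow> nat \<Rightarrow> complex mat" where
  "first_cols p q = 1\<^sub>m p @\<^sub>r 0\<^sub>m q p"

definition last_cols :: "nat \<Rightarrow> nat \<Rightarrow> complex mat" where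
  "last_cols p q = 0\<^sub>m p q @\<^sub>r 1\<^sub>m q"

lemma first_cols_carrier: "first_cols p q \<in> carrier_mat (p + q) p"
  and last_cols_carrier: "last_cols p q \<in> carrier_mat (p + q) q"
  by (simp_all add: first_cols_def last_cols_def carrier_append_rows)

lemma first_cols_index: "i < p + q \<Longrightarrow> l < p \<Longrightarrow> first_cols p q $$ (i, l) = (if i = l then 1 else 0)"
  by (auto simp: first_cols_def append_rows_def)

lemma last_cols_index: "i < p + q \<Longrightarrow> l < q \<Longrightarrow> last_cols p q $$ (i, l) = (if i = p + l then 1 else 0)"
  by (auto simp: last_cols_def append_rows_def)

lemma append_first_last_cols: "append_cols (first_cols p q) (last_cols p q) = 1\<^sub>m (p + q)"
  by (intro eq_matI) (auto simp: append_cols_def first_cols_def last_cols_def append_rows_def)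

text \<open>The two inclusions side by side form the identity matrix; the claims are the blocks of
  its two products with its adjoint.\<close>

lemma first_last_cols_orthonormal:
  "mat_adjoint (first_cols p q) * first_cols p q = 1\<^sub>m p"
  "mat_adjoint (last_cols p q) * last_cols p q = 1\<^sub>m q"
  "first_cols p q * mat_adjoint (first_cols p q) + last_cols p q * mat_adjoint (last_cols p q) = 1\<^sub>m (p + q)"
proof -
  note c = first_cols_carrier[of p q] last_cols_carrier[of p q]
  have "four_block_mat (mat_adjoint (first_cols p q) * first_cols p q) (mat_adjoint (first_cols p q) * last_cols p q)
      (mat_adjoint (last_cols p q) * first_cols p q) (mat_adjoint (last_cols p q) * last_cols p q)
    = four_block_mat (1\<^sub>m p) (0\<^sub>m p q) (0\<^sub>m q p) (1\<^sub>m q)"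
    unfolding adjoint_append_cols_mult[OF c, symmetric] append_first_last_cols four_block_one_mat by simp
  thus "mat_adjoint (first_cols p q) * first_cols p q = 1\<^sub>m p"
    "mat_adjoint (last_cols p q) * last_cols p q = 1\<^sub>m q"
    by (subst (asm) four_block_eq_iff[of _ p p _ q _ q]; use c in auto)+
  show "first_cols p q * mat_adjoint (first_cols p q) + last_cols p q * mat_adjoint (last_cols p q) = 1\<^sub>m (p + q)"
    unfolding append_cols_mult_adjoint[OF c, symmetric] append_first_last_cols by simp
qed

lemma mult_first_cols_index:
  assumes "M \<in> carrier_mat d (p + q)" "i < d" "l < p"
  shows "(M * first_cols p q) $$ (i, l) = M $$ (i, l)"
proof -
  have "(M * first_cols p q) $$ (i, l) = (\<Sum>x<p + q. M $$ (i, x) * (if x = l then 1 else 0))"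
    using assms carrier_matD[OF first_cols_carrier[of p q]]
    by (simp add: scalar_prod_def atLeast0LessThan first_cols_index)
  also have "\<dots> = (\<Sum>x<p + q. if x = l then M $$ (i, x) else 0)" by (intro sum.cong) auto
  finally show ?thesis using assms by simp
qed

lemma adjoint_last_cols_mult_index:
  assumes "M \<in> carrier_mat (p + q) d" "i < q" "l < d"
  shows "(mat_adjoint (last_cols p q) * M) $$ (i, l) = M $$ (p + i, l)"
proof -
  have "(mat_adjoint (last_cols p q) * M) $$ (i, l) = (\<Sum>x<p + q. cnj (if x = p + i then 1 else 0) * M $$ (x, l))"
    using assms carrier_matD[OF last_cols_carrier[of p q]]
    by (simp add: scalar_prod_def atLeast0LessThan last_cols_index)
  also have "\<dots> = (\<Sum>x<p + q. if x = p + i then M $$ (x, l) else 0)" by (intro sum.cong) auto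
  finally show ?thesis using assms by simp
qed

section \<open>Powers of the skew-Hermitian block matrix\<close>

definition skew_block :: "nat \<Rightarrow> nat \<Rightarrow> complex mat \<Rightarrow> complex mat" where
  "skew_block p q K = four_block_mat (0\<^sub>m p p) (- mat_adjoint K) K (0\<^sub>m q q)"

lemma skew_block_carrier: "K \<in> carrier_mat q p \<Longrightarrow> skew_block p q K \<in> carrier_mat (p + q) (p + q)"
  by (auto simp: skew_block_def)

lemma skew_block_adjoint:
  assumes "K \<in> carrier_mat q p"
  shows "mat_adjoint (skew_block p q K) = - skew_block p q K"
  using assms by (intro eq_matI) (auto simp: skew_block_def)

lemma skew_block_smult:
  assumes "K \<in> carrier_mat q p"
  shows "skew_block p q (complex_of_real t \<cdot>\<^sub>m K) = complex_of_real t \<cdot>\<^sub>m skew_block p q K"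
  using assms by (intro eq_matI) (auto simp: skew_block_def)

lemma skew_block_parity:
  assumes K: "K \<in> carrier_mat q p" and rl: "r < p + q" "l < p + q" "(r < p \<longleftrightarrow> l < p) \<longleftrightarrow> odd s"
  shows "(skew_block p q K ^\<^sub>m s) $$ (r, l) = 0"
  by (rule pow_mat_parity[OF skew_block_carrier[OF K] _ rl]) (use K in \<open>auto simp: skew_block_def\<close>)

text \<open>The square of the block matrix maps the first coordinate block into itself and acts
  there as \<open>- K\<^sup>* K\<close>. This is how the arguments of \<open>pade_alpha\<close> and
  \<open>pade_beta\<close> arise.\<close>

lemma skew_block_mult_first_cols:
  assumes K: "K \<in> carrier_mat q p"
  shows "skew_block p q K * first_cols p q = 0\<^sub>m p p @\<^sub>r K"
    and "skew_block p q K * (skew_block p q K * first_cols p q) = first_cols p q * (- (mat_adjoint K * K))"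
proof -
  show 1: "skew_block p q K * first_cols p q = 0\<^sub>m p p @\<^sub>r K"
    unfolding skew_block_def first_cols_def append_rows_def using K
    by (subst mult_four_block_mat[of _ p p _ q _ q _ _ p _ 0]) (auto intro!: cong_four_block_mat)
  have "skew_block p q K * (0\<^sub>m p p @\<^sub>r K) = - (mat_adjoint K * K) @\<^sub>r 0\<^sub>m q p"
    unfolding skew_block_def append_rows_def using K
    by (subst mult_four_block_mat[of _ p p _ q _ q _ _ p _ 0]) (auto simp: uminus_mult_left_mat intro!: cong_four_block_mat)
  also have "\<dots> = first_cols p q * (- (mat_adjoint K * K))"
  proof -
    \<comment> \<open>Row appending is a block matrix with right blocks of width zero. Padding the
      second factor by empty blocks gives it the matching shape for block multiplication.\<close>
    have "first_cols p q * four_block_mat (- (mat_adjoint K * K)) (0\<^sub>m p 0) (0\<^sub>m 0 p) (0\<^sub>m 0 0) =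
        four_block_mat (- (mat_adjoint K * K)) (0\<^sub>m p 0) (0\<^sub>m q p) (0\<^sub>m q 0)"
      unfolding first_cols_def append_rows_def using K
      by (subst mult_four_block_mat[of _ p p _ 0 _ q _ _ p _ 0]) (auto intro!: cong_four_block_mat)
    moreover have "four_block_mat (- (mat_adjoint K * K)) (0\<^sub>m p 0) (0\<^sub>m 0 p) (0\<^sub>m 0 0) = - (mat_adjoint K * K)"
      using K by (intro eq_matI) auto
    ultimately show ?thesis using K by (simp add: append_rows_def)
  qed
  finally show "skew_block p q K * (skew_block p q K * first_cols p q) = first_cols p q * (- (mat_adjoint K * K))"
    unfolding 1 .
qed

lemma skew_block_pow_first_cols:
  fixes K :: "complex mat"
  assumes K: "K \<in> carrier_mat q p"
  defines "Z \<equiv> mat_adjoint K * K"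
  shows "skew_block p q K ^\<^sub>m (2 * j) * first_cols p q = first_cols p q * (- Z) ^\<^sub>m j"
    and "skew_block p q K ^\<^sub>m (2 * j + 1) * first_cols p q = (0\<^sub>m p p @\<^sub>r K) * (- Z) ^\<^sub>m j"
proof -
  let ?B = "skew_block p q K" and ?J = "first_cols p q"
  note B = skew_block_carrier[OF K] and J = first_cols_carrier[of p q]
  have Z: "- Z \<in> carrier_mat p p" unfolding Z_def using K by auto
  have Zj: "(- Z) ^\<^sub>m j \<in> carrier_mat p p" for j using Z by (rule pow_carrier_mat)
  have Bj: "?B ^\<^sub>m j \<in> carrier_mat (p + q) (p + q)" for j using B by (rule pow_carrier_mat)
  show e: "?B ^\<^sub>m (2 * j) * ?J = ?J * (- Z) ^\<^sub>m j" for j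
  proof (induction j)
    case (Suc j)
    have "?B ^\<^sub>m (2 * Suc j) = ?B ^\<^sub>m (2 * j) * ?B * ?B" by simp
    hence "?B ^\<^sub>m (2 * Suc j) * ?J = ?B ^\<^sub>m (2 * j) * (?B * (?B * ?J))"
      using assoc_mult_mat[OF Bj B mult_carrier_mat[OF B J]] assoc_mult_mat[OF mult_carrier_mat[OF Bj B] B J]
      by simp
    also have "\<dots> = ?B ^\<^sub>m (2 * j) * ?J * (- Z)"
      unfolding skew_block_mult_first_cols(2)[OF K, folded Z_def] using assoc_mult_mat[OF Bj J Z] by simp
    also have "\<dots> = ?J * (- Z) ^\<^sub>m Suc j"
      unfolding Suc using assoc_mult_mat[OF J Zj Z] by simp
    finally show ?case .
  qed (use J B Z in auto)
  have "?B ^\<^sub>m (2 * j + 1) = ?B * ?B ^\<^sub>m (2 * j)"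
    using pow_mat_add[OF B, of 1 "2 * j"] B by simp
  hence "?B ^\<^sub>m (2 * j + 1) * ?J = ?B * (?B ^\<^sub>m (2 * j) * ?J)"
    using assoc_mult_mat[OF B Bj J] by simp
  also have "\<dots> = ?B * ?J * (- Z) ^\<^sub>m j"
    unfolding e using assoc_mult_mat[OF B J Zj] by simp
  finally show "?B ^\<^sub>m (2 * j + 1) * ?J = (0\<^sub>m p p @\<^sub>r K) * (- Z) ^\<^sub>m j"
    unfolding skew_block_mult_first_cols(1)[OF K] .
qed

section \<open>The argument of the QR factor as a polynomial in the block matrix\<close>

lemma append_cols_mult_append_rows:
  assumes "A \<in> carrier_mat r p" "B \<in> carrier_mat r q" "C \<in> carrier_mat p a" "D \<in> carrier_mat q a"
  shows "append_cols A B * (C @\<^sub>r D) = A * C + B * D"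
proof -
  have "append_cols A B * (C @\<^sub>r D) = append_cols (A * C + B * D) (A * 0\<^sub>m p 0 + B * 0\<^sub>m q 0)"
    unfolding append_rows_def using assms by (simp add: append_cols_mult_four_block[OF assms(1,2), of _ a _ 0])
  also have "\<dots> = A * C + B * D"
    unfolding append_cols_def using assms by (intro eq_matI) auto
  finally show ?thesis .
qed

lemma sum_even_odd:
  fixes f :: "nat \<Rightarrow> 'b :: comm_monoid_add"
  shows "(\<Sum>k\<le>n. f k) = (\<Sum>j\<le>n div 2. f (2 * j)) + (\<Sum>j<(n + 1) div 2. f (2 * j + 1))"
proof -
  have "{..n} = (\<lambda>j. 2 * j) ` {..n div 2} \<union> (\<lambda>j. 2 * j + 1) ` {..<(n + 1) div 2}"
  proof (intro equalityI subsetI)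
    fix k assume "k \<in> {..n}"
    thus "k \<in> (\<lambda>j. 2 * j) ` {..n div 2} \<union> (\<lambda>j. 2 * j + 1) ` {..<(n + 1) div 2}"
      by (cases "even k") (auto elim!: evenE oddE)
  qed auto
  hence "(\<Sum>k\<le>n. f k) = (\<Sum>k\<in>(\<lambda>j. 2 * j) ` {..n div 2}. f k) + (\<Sum>k\<in>(\<lambda>j. 2 * j + 1) ` {..<(n + 1) div 2}. f k)"
    by (simp only:) (rule sum.union_disjoint, auto, presburger)
  thus ?thesis by (simp add: sum.reindex inj_on_def)
qed

text \<open>With \<open>Z = K\<^sup>* K = H\<^sup>* H\<close> and \<open>U = (Y Y')\<close>, even
  powers give \<open>U B ^\<^sub>m (2 * j) J = Y (- Z) ^\<^sub>m j\<close> and odd ones give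
  \<open>H (- Z) ^\<^sub>m j\<close>. Hence \<alpha> and \<beta> carry the even and the odd part of
  a single polynomial in \<open>t B\<close>.\<close>

lemma pade_representative_entry:
  assumes Y: "Y \<in> carrier_mat m p" and Y': "Y' \<in> carrier_mat m q" and K: "K \<in> carrier_mat q p"
    and oY': "mat_adjoint Y' * Y' = 1\<^sub>m q" and il: "i < m" "l < p"
  defines "H \<equiv> Y' * K"
  shows "(Y * pade_alpha n (complex_of_real (t\<^sup>2) \<cdot>\<^sub>m (mat_adjoint H * H))
      + (complex_of_real t \<cdot>\<^sub>m H) * pade_beta n (complex_of_real (t\<^sup>2) \<cdot>\<^sub>m (mat_adjoint H * H))) $$ (i, l)
    = (\<Sum>k\<le>n. complex_of_real (pade_coeff n k) * complex_of_real t ^ k *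
        (append_cols Y Y' * (skew_block p q K ^\<^sub>m k * first_cols p q)) $$ (i, l))"
proof -
  define Z where "Z = mat_adjoint K * K"
  let ?t = "complex_of_real t" and ?a = "\<lambda>k. complex_of_real (pade_coeff n k)"
  have Z: "Z \<in> carrier_mat p p" unfolding Z_def using K by auto
  have nZ: "- Z \<in> carrier_mat p p" using Z by simp
  have Zj: "(- Z) ^\<^sub>m j \<in> carrier_mat p p" for j using nZ by (rule pow_carrier_mat)
  have H: "H \<in> carrier_mat m p" unfolding H_def using Y' K by auto
  have HH: "mat_adjoint H * H = Z"
    unfolding H_def Z_def by (rule adjoint_mult_self[OF Y' K oY'])
  have "- (complex_of_real (t\<^sup>2) \<cdot>\<^sub>m Z) = ?t\<^sup>2 \<cdot>\<^sub>m (- Z)"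
    using Z by (intro eq_matI) auto
  hence pw: "(- (complex_of_real (t\<^sup>2) \<cdot>\<^sub>m Z)) ^\<^sub>m j = ?t ^ (2 * j) \<cdot>\<^sub>m (- Z) ^\<^sub>m j" for j
    using smult_pow_mat[OF nZ, of "?t\<^sup>2" j] by (simp add: power_mult)
  have al: "pade_alpha n (complex_of_real (t\<^sup>2) \<cdot>\<^sub>m Z) \<in> carrier_mat p p"
    and be: "pade_beta n (complex_of_real (t\<^sup>2) \<cdot>\<^sub>m Z) \<in> carrier_mat p p"
    using Z by (simp_all add: pade_alpha_def pade_beta_def)
  have ent: "(X * (- Z) ^\<^sub>m j) $$ (i, l) = (\<Sum>x<p. X $$ (i, x) * ((- Z) ^\<^sub>m j) $$ (x, l))"
    if "X \<in> carrier_mat m p" for X j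
    using il carrier_matD[OF that] carrier_matD[OF Zj[of j]] carrier_matD[OF Z]
    by (simp add: scalar_prod_def atLeast0LessThan)
  have "(Y * pade_alpha n (complex_of_real (t\<^sup>2) \<cdot>\<^sub>m Z)) $$ (i, l) =
      (\<Sum>x<p. Y $$ (i, x) * (\<Sum>j\<le>n div 2. ?a (2 * j) * (?t ^ (2 * j) * ((- Z) ^\<^sub>m j) $$ (x, l))))"
    using Y al Z Zj il unfolding pade_alpha_def pw
    by (auto simp: scalar_prod_def atLeast0LessThan carrier_matD[OF Zj] intro!: sum.cong)
  also have "\<dots> = (\<Sum>j\<le>n div 2. ?a (2 * j) * ?t ^ (2 * j) * (Y * (- Z) ^\<^sub>m j) $$ (i, l))"
    unfolding ent[OF Y] sum_distrib_left by (subst sum.swap) (simp add: mult_ac)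
  finally have e: "(Y * pade_alpha n (complex_of_real (t\<^sup>2) \<cdot>\<^sub>m Z)) $$ (i, l) =
      (\<Sum>j\<le>n div 2. ?a (2 * j) * ?t ^ (2 * j) * (Y * (- Z) ^\<^sub>m j) $$ (i, l))" .
  have "((?t \<cdot>\<^sub>m H) * pade_beta n (complex_of_real (t\<^sup>2) \<cdot>\<^sub>m Z)) $$ (i, l) =
      (\<Sum>x<p. ?t * H $$ (i, x) * (\<Sum>j<(n + 1) div 2. ?a (2 * j + 1) * (?t ^ (2 * j) * ((- Z) ^\<^sub>m j) $$ (x, l))))"
    using H be Z Zj il unfolding pade_beta_def pw
    by (auto simp: scalar_prod_def atLeast0LessThan carrier_matD[OF Zj] intro!: sum.cong)
  also have "\<dots> = (\<Sum>j<(n + 1) div 2. ?a (2 * j + 1) * ?t ^ (2 * j + 1) * (H * (- Z) ^\<^sub>m j) $$ (i, l))"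
    unfolding ent[OF H] sum_distrib_left by (subst sum.swap) (simp add: mult_ac)
  finally have o: "((?t \<cdot>\<^sub>m H) * pade_beta n (complex_of_real (t\<^sup>2) \<cdot>\<^sub>m Z)) $$ (i, l) =
      (\<Sum>j<(n + 1) div 2. ?a (2 * j + 1) * ?t ^ (2 * j + 1) * (H * (- Z) ^\<^sub>m j) $$ (i, l))" .
  have U: "append_cols Y Y' \<in> carrier_mat m (p + q)" using Y Y' by simp
  have "append_cols Y Y' * first_cols p q = Y"
    unfolding first_cols_def using append_cols_mult_append_rows[OF Y Y', of "1\<^sub>m p" p "0\<^sub>m q p"] Y Y' by simp
  hence Ue: "append_cols Y Y' * (skew_block p q K ^\<^sub>m (2 * j) * first_cols p q) = Y * (- Z) ^\<^sub>m j" for j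
    unfolding skew_block_pow_first_cols(1)[OF K, folded Z_def]
    using assoc_mult_mat[OF U first_cols_carrier Zj] by simp
  have KR: "0\<^sub>m p p @\<^sub>r K \<in> carrier_mat (p + q) p" using K by (intro carrier_append_rows) auto
  have "append_cols Y Y' * (0\<^sub>m p p @\<^sub>r K) = H"
    unfolding H_def using append_cols_mult_append_rows[OF Y Y', of "0\<^sub>m p p" p K] Y Y' K by simp
  hence Uo: "append_cols Y Y' * (skew_block p q K ^\<^sub>m (2 * j + 1) * first_cols p q) = H * (- Z) ^\<^sub>m j" for j
    unfolding skew_block_pow_first_cols(2)[OF K, folded Z_def]
    using assoc_mult_mat[OF U KR Zj] by simp
  show ?thesis
    unfolding HH sum_even_odd[of _ n] Ue Uo e[symmetric] o[symmetric] using Y H al be il by simp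
qed

section \<open>Gram matrices near an orthonormal matrix\<close>

lemma mat_bigo_const:
  assumes "X \<in> carrier_mat m p"
  shows "mat_bigo F m p (\<lambda>_. 1) (\<lambda>_. X)"
  by (rule mat_bigoI) (use assms in auto)

text \<open>The Gram defect equals \<open>(A - Y)\<^sup>* A + Y\<^sup>* (A - Y)\<close>; each
  summand is a product of a bounded matrix and one of order \<open>h\<close>.\<close>

lemma near_orthonormal_gram_bigo:
  fixes A :: "'a \<Rightarrow> complex mat"
  assumes Y: "Y \<in> carrier_mat m p" "mat_adjoint Y * Y = 1\<^sub>m p"
    and A: "\<And>t. A t \<in> carrier_mat m p" and d: "mat_bigo F m p h (\<lambda>t. A t - Y)" and h0: "(h \<longlongrightarrow> 0) F"
  shows "mat_bigo F p p h (\<lambda>t. mat_adjoint (A t) * A t - 1\<^sub>m p)"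
proof -
  have h1: "h \<in> O[F](\<lambda>_. 1)" by (rule tendsto_zero_imp_bigo_1[OF h0])
  have bA: "mat_bigo F m p (\<lambda>_. 1) A"
  proof (rule mat_bigo_ev_eq)
    show "mat_bigo F m p (\<lambda>_. 1) (\<lambda>t. (A t - Y) + Y)"
      by (intro mat_bigo_add mat_bigo_trans[OF d h1] mat_bigo_const Y)
    have "(A t - Y) + Y = A t" for t
      using A[of t] Y by (intro eq_matI) auto
    thus "\<forall>\<^sub>F t in F. (A t - Y) + Y = A t" by simp
  qed
  have "mat_bigo F p p (\<lambda>t. h t * 1) (\<lambda>t. mat_adjoint (A t - Y) * A t)"
    "mat_bigo F p p (\<lambda>t. 1 * h t) (\<lambda>t. mat_adjoint Y * (A t - Y))"
    by (rule mat_bigo_mult mat_bigo_adjoint d bA mat_bigo_const mat_adjoint_carrier Y)+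
  hence "mat_bigo F p p h (\<lambda>t. mat_adjoint (A t - Y) * A t + mat_adjoint Y * (A t - Y))"
    by (intro mat_bigo_add) simp_all
  moreover have "mat_adjoint (A t - Y) * A t + mat_adjoint Y * (A t - Y) = mat_adjoint (A t) * A t - 1\<^sub>m p" for t
  proof -
    have "mat_adjoint (A t - Y) = mat_adjoint (A t) - mat_adjoint Y"
      using A[of t] Y by (intro eq_matI) auto
    moreover have "(mat_adjoint (A t) - mat_adjoint Y) * A t = mat_adjoint (A t) * A t - mat_adjoint Y * A t"
      using A[of t] Y by (intro minus_mult_distrib_mat[of _ p m _ _ p]) auto
    moreover have "mat_adjoint Y * (A t - Y) = mat_adjoint Y * A t - 1\<^sub>m p"
      using A[of t] Y mult_minus_distrib_mat[of "mat_adjoint Y" p m "A t" p Y] by simp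
    ultimately show ?thesis using A[of t] Y by (intro eq_matI) auto
  qed
  ultimately show ?thesis by simp
qed

section \<open>Approximation of the exponential map\<close>

theorem corollary2p4:
  fixes m p n :: nat and Y H :: "complex mat" and \<Q> :: "complex mat \<Rightarrow> complex mat"
  assumes "p \<le> m"
    and "Y \<in> carrier_mat m p" and "orthonormal_cols Y"
    and "H \<in> grassmann_tangent Y"
    and "\<And>A. A \<in> carrier_mat m p \<Longrightarrow> vec_space.rank m A = p \<Longrightarrow> \<exists>R. qr_decomposition A (\<Q> A) R"
  shows "(\<lambda>t::real.
            grassmann_dist
              (\<Q> (Y * pade_alpha n (complex_of_real (t\<^sup>2) \<cdot>\<^sub>m (mat_adjoint H * H))
                  + (complex_of_real t \<cdot>\<^sub>m H)
                      * pade_beta n (complex_of_real (t\<^sup>2) \<cdot>\<^sub>m (mat_adjoint H * H))))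
              (grassmann_exp Y (complex_of_real t \<cdot>\<^sub>m H)))
         \<in> O[at 0](\<lambda>t. t ^ (2 * n + 1))"
proof -
  note Y = assms(2)
  define q where "q = m - p"
  have m: "m = p + q" using assms(1) by (simp add: q_def)
  obtain Y' K where Y': "Y' \<in> orth_complements Y" and K: "K \<in> carrier_mat q p" and H: "H = Y' * K"
    using assms(4) Y by (auto simp: grassmann_tangent_def q_def)
  note o = orth_complementsD[OF Y Y', folded q_def]
  define U where "U = append_cols Y Y'"
  define B where "B = skew_block p q K"
  define J where "J = first_cols p q"
  define J' where "J' = last_cols p q"
  define e where "e t = mat_exp (complex_of_real t \<cdot>\<^sub>m B)" for t
  have U: "U \<in> carrier_mat m m" unfolding U_def m using append_cols_carrier[OF Y o(2)] m by simp
  have UU: "mat_adjoint U * U = 1\<^sub>m m"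
    using Y' U by (simp add: orth_complements_def U_def unitary_mat_iff)
  have B: "B \<in> carrier_mat m m" unfolding B_def m by (rule skew_block_carrier[OF K])
  have J: "J \<in> carrier_mat m p" "J' \<in> carrier_mat m q"
    unfolding J_def J'_def m by (rule first_cols_carrier last_cols_carrier)+
  have JJ: "mat_adjoint J * J = 1\<^sub>m p" "mat_adjoint J' * J' = 1\<^sub>m q" "J * mat_adjoint J + J' * mat_adjoint J' = 1\<^sub>m m"
    unfolding J_def J'_def m by (rule first_last_cols_orthonormal)+
  have e: "e t \<in> carrier_mat m m" for t unfolding e_def using B by simp
  have e_adj: "mat_adjoint (e t) = e (- t)" for t
    unfolding e_def using mat_exp_skew_adjoint[OF B] skew_block_adjoint[OF K] by (simp add: B_def)
  have ee: "e (- t) * e t = 1\<^sub>m m" for t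
    unfolding e_def using mat_exp_smult_add[OF B, of "- complex_of_real t" "complex_of_real t"] mat_exp_smult_0[OF B]
    by simp
  \<comment> \<open>\<open>G t\<close> is unitary. Its first \<open>p\<close> columns represent the
    exponential and the remaining ones span the orthogonal complement.\<close>
  define G where "G t = U * e t" for t
  have G: "G t \<in> carrier_mat m m" for t unfolding G_def using U e by simp
  have GG: "mat_adjoint (G t) * G t = 1\<^sub>m m" for t
    unfolding G_def using adjoint_mult_self[OF U e UU] ee e_adj by simp
  have GG': "G t * mat_adjoint (G t) = 1\<^sub>m m" for t
    using mat_mult_left_right_inverse[OF mat_adjoint_carrier[OF G] G GG] .
  \<comment> \<open>This identity turns the components of \<open>A t\<close> with respect to
    \<open>G t\<close> into entries of \<open>exp (- t B) \<theta>(t B)\<close>.\<close>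
  have Gadj: "mat_adjoint (G t) * U = e (- t)" for t
    unfolding G_def mat_adjoint_mult[OF U e] e_adj
    using assoc_mult_mat[OF e mat_adjoint_carrier[OF U] U] UU e[of "- t"] by simp
  define A where "A t = Y * pade_alpha n (complex_of_real (t\<^sup>2) \<cdot>\<^sub>m (mat_adjoint H * H))
      + (complex_of_real t \<cdot>\<^sub>m H) * pade_beta n (complex_of_real (t\<^sup>2) \<cdot>\<^sub>m (mat_adjoint H * H))" for t
  have Hc: "H \<in> carrier_mat m p" unfolding H using o(2) K by auto
  have A: "A t \<in> carrier_mat m p" for t
    unfolding A_def using Y Hc by (auto simp: pade_beta_def)
  let ?a = "\<lambda>k. complex_of_real (pade_coeff n k)"
  have A_entry: "A t $$ (i, l) = (\<Sum>k\<le>n. ?a k * complex_of_real t ^ k * (U * (B ^\<^sub>m k * J)) $$ (i, l))"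
    if "i < m" "l < p" for t i l
    unfolding A_def H U_def B_def J_def by (rule pade_representative_entry[OF Y o(2) K o(6) that])
  have exp_eq: "grassmann_exp Y (complex_of_real t \<cdot>\<^sub>m H) = G t * J" for t
  proof -
    have "complex_of_real t \<cdot>\<^sub>m H = Y' * (complex_of_real t \<cdot>\<^sub>m K)"
      unfolding H using mult_smult_distrib[OF o(2) K] by simp
    hence "grassmann_exp Y (complex_of_real t \<cdot>\<^sub>m H) = grassmann_exp_rep Y Y' (complex_of_real t \<cdot>\<^sub>m K)"
      using grassmann_exp_eq[OF Y Y', of "complex_of_real t \<cdot>\<^sub>m K"] K by (simp add: q_def)
    also have "\<dots> = U * mat_exp (skew_block p q (complex_of_real t \<cdot>\<^sub>m K)) * J"
      using Y by (simp add: grassmann_exp_rep_def Let_def q_def[symmetric] U_def J_def first_cols_def skew_block_def)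
    finally show ?thesis by (simp add: skew_block_smult[OF K] G_def e_def B_def)
  qed
  have Bk: "B ^\<^sub>m k \<in> carrier_mat m m" for k using B by (rule pow_carrier_mat)
  have UJ: "U * J = Y"
    unfolding U_def J_def first_cols_def using append_cols_mult_append_rows[OF Y o(2), of "1\<^sub>m p" p "0\<^sub>m q p"] Y o(2) by simp
  let ?h = "\<lambda>t. complex_of_real t"
  have h0: "(?h \<longlongrightarrow> 0) (at 0)"
    using tendsto_of_real[OF tendsto_ident_at[of "0::real" UNIV], where 'a = complex] by simp
  \<comment> \<open>The constant term is \<open>U J = Y\<close>, since the Pade coefficient at 0 is
    1; every other term contains a factor \<open>t\<close>. First order suffices here, because this
    only serves to bring the Gram matrix close to the identity.\<close>
  have AY: "mat_bigo (at 0) m p ?h (\<lambda>t. A t - Y)"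
  proof (rule mat_bigoI)
    show "\<forall>\<^sub>F t in at 0. A t - Y \<in> carrier_mat m p"
      using Y by (simp add: minus_carrier_mat)
    fix i l assume il: "i < m" "l < p"
    have "(A t - Y) $$ (i, l) = (\<Sum>k\<in>{1..n}. ?a k * ?h t ^ k * (U * (B ^\<^sub>m k * J)) $$ (i, l))" for t
    proof -
      have "{..n} = insert 0 {1..n}" by auto
      hence "A t $$ (i, l) = Y $$ (i, l) + (\<Sum>k\<in>{1..n}. ?a k * ?h t ^ k * (U * (B ^\<^sub>m k * J)) $$ (i, l))"
        unfolding A_entry[OF il] using B J UJ by (simp add: pade_coeff_0)
      thus ?thesis using A[of t] Y il by simp
    qed
    moreover have "(\<lambda>t. \<Sum>k\<in>{1..n}. ?a k * ?h t ^ k * (U * (B ^\<^sub>m k * J)) $$ (i, l)) \<in> O[at 0](?h)"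
    proof (rule big_sum_in_bigo)
      fix k assume "k \<in> {1..n}"
      then obtain k' where k: "k = Suc k'" by (cases k) auto
      have "(\<lambda>t. ?h t * (?a k * ?h t ^ k' * (U * (B ^\<^sub>m k * J)) $$ (i, l))) \<in> O[at 0](?h)"
      proof (rule mult_bigo_right[OF landau_o.big_refl])
        have "((\<lambda>t. ?a k * ?h t ^ k' * (U * (B ^\<^sub>m k * J)) $$ (i, l)) \<longlongrightarrow>
            ?a k * 0 ^ k' * (U * (B ^\<^sub>m k * J)) $$ (i, l)) (at 0)"
          by (intro tendsto_intros h0)
        thus "(\<lambda>t. ?a k * ?h t ^ k' * (U * (B ^\<^sub>m k * J)) $$ (i, l)) \<in> O[at 0](\<lambda>_. 1)"
          by (intro bigoI_tendsto[where g = "\<lambda>_. 1"]) auto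
      qed
      thus "(\<lambda>t. ?a k * ?h t ^ k * (U * (B ^\<^sub>m k * J)) $$ (i, l)) \<in> O[at 0](?h)"
        by (simp add: k mult_ac)
    qed
    ultimately show "(\<lambda>t. (A t - Y) $$ (i, l)) \<in> O[at 0](?h)" by simp
  qed
  have gram: "mat_bigo (at 0) p p ?h (\<lambda>t. mat_adjoint (A t) * A t - 1\<^sub>m p)"
    by (rule near_orthonormal_gram_bigo[OF Y o(3) A AY h0])
  define E where "E t = G t * J" for t
  define P where "P t = G t * J'" for t
  have E: "E t \<in> carrier_mat m p" and P: "P t \<in> carrier_mat m q" for t
    unfolding E_def P_def by (rule mult_carrier_mat[OF G] J)+
  have EP: "mat_adjoint (E t) * E t = 1\<^sub>m p" "mat_adjoint (P t) * P t = 1\<^sub>m q"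
    "E t * mat_adjoint (E t) + P t * mat_adjoint (P t) = 1\<^sub>m m" for t
  proof -
    show "mat_adjoint (E t) * E t = 1\<^sub>m p" "mat_adjoint (P t) * P t = 1\<^sub>m q"
      unfolding E_def P_def using adjoint_mult_self[OF G J(1) GG] adjoint_mult_self[OF G J(2) GG] JJ by simp_all
    \<comment> \<open>This reduces the completeness relation of \<open>E t\<close> and
      \<open>P t\<close> to that of \<open>J\<close> and \<open>J'\<close>, conjugated by
      \<open>G t\<close>.\<close>
    have X: "G t * X * mat_adjoint (G t * X) = G t * (X * mat_adjoint X) * mat_adjoint (G t)"
      if "X \<in> carrier_mat m r" for X r
    proof -
      note X = that mat_adjoint_carrier[OF that] and Ga = mat_adjoint_carrier[OF G[of t]]
      have "G t * X * (mat_adjoint X * mat_adjoint (G t)) = G t * (X * (mat_adjoint X * mat_adjoint (G t)))"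
        by (rule assoc_mult_mat[OF G X(1) mult_carrier_mat[OF X(2) Ga]])
      also have "X * (mat_adjoint X * mat_adjoint (G t)) = X * mat_adjoint X * mat_adjoint (G t)"
        by (rule assoc_mult_mat[OF X Ga, symmetric])
      also have "G t * \<dots> = G t * (X * mat_adjoint X) * mat_adjoint (G t)"
        by (rule assoc_mult_mat[OF G mult_carrier_mat[OF X] Ga, symmetric])
      finally show ?thesis unfolding mat_adjoint_mult[OF G that] .
    qed
    have "E t * mat_adjoint (E t) + P t * mat_adjoint (P t) =
        G t * (J * mat_adjoint J + J' * mat_adjoint J') * mat_adjoint (G t)"
      unfolding E_def P_def X[OF J(1)] X[OF J(2)] using G[of t] J
        mult_add_distrib_mat[of "G t" m m "J * mat_adjoint J" m "J' * mat_adjoint J'"]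
        add_mult_distrib_mat[of "G t * (J * mat_adjoint J)" m m "G t * (J' * mat_adjoint J')" "mat_adjoint (G t)" m]
      by (metis mat_adjoint_carrier mult_carrier_mat)
    thus "E t * mat_adjoint (E t) + P t * mat_adjoint (P t) = 1\<^sub>m m"
      unfolding JJ(3) using G[of t] GG' by simp
  qed
  let ?g = "\<lambda>t. complex_of_real t ^ (2 * n + 1)"
  \<comment> \<open>The part of \<open>A t\<close> orthogonal to the exponential is the lower left
    block of \<open>exp (- t B) \<theta>(t B)\<close>, whose entries sit at row \<open>p + i\<close>
    and column \<open>l < p\<close>.\<close>
  have PA: "mat_bigo (at 0) q p ?g (\<lambda>t. mat_adjoint (P t) * A t)"
  proof (rule mat_bigoI)
    show "\<forall>\<^sub>F t in at 0. mat_adjoint (P t) * A t \<in> carrier_mat q p"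
      by (intro always_eventually allI mult_carrier_mat[OF mat_adjoint_carrier[OF P] A])
    fix i l assume il: "i < q" "l < p"
    have "(mat_adjoint (P t) * A t) $$ (i, l) =
        (\<Sum>k\<le>n. ?a k * ?h t ^ k * (mat_exp (- ?h t \<cdot>\<^sub>m B) * B ^\<^sub>m k) $$ (p + i, l))" for t
    proof -
      have PU: "(mat_adjoint (P t) * (U * (B ^\<^sub>m k * J))) $$ (i, l) = (e (- t) * B ^\<^sub>m k) $$ (p + i, l)" for k
      proof -
        have BkJ: "B ^\<^sub>m k * J \<in> carrier_mat m p" by (rule mult_carrier_mat[OF Bk J(1)])
        have eB: "e (- t) * B ^\<^sub>m k \<in> carrier_mat m m" by (rule mult_carrier_mat[OF e Bk])
        have "mat_adjoint (P t) * (U * (B ^\<^sub>m k * J)) = mat_adjoint J' * (mat_adjoint (G t) * (U * (B ^\<^sub>m k * J)))"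
          unfolding P_def mat_adjoint_mult[OF G J(2)]
          by (rule assoc_mult_mat[OF mat_adjoint_carrier[OF J(2)] mat_adjoint_carrier[OF G] mult_carrier_mat[OF U BkJ]])
        also have "mat_adjoint (G t) * (U * (B ^\<^sub>m k * J)) = e (- t) * (B ^\<^sub>m k * J)"
          using assoc_mult_mat[OF mat_adjoint_carrier[OF G] U BkJ] Gadj by simp
        also have "\<dots> = e (- t) * B ^\<^sub>m k * J"
          by (rule assoc_mult_mat[OF e Bk J(1), symmetric])
        finally have "(mat_adjoint (P t) * (U * (B ^\<^sub>m k * J))) $$ (i, l) = (e (- t) * B ^\<^sub>m k * J) $$ (p + i, l)"
          unfolding J'_def using adjoint_last_cols_mult_index[of "e (- t) * B ^\<^sub>m k * J" p q p i l] il eB J m by simp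
        thus ?thesis
          unfolding J_def using mult_first_cols_index[of "e (- t) * B ^\<^sub>m k" m p q "p + i" l] il eB m by simp
      qed
      have "(mat_adjoint (P t) * A t) $$ (i, l) = (\<Sum>x<m. mat_adjoint (P t) $$ (i, x) *
          (\<Sum>k\<le>n. ?a k * ?h t ^ k * (U * (B ^\<^sub>m k * J)) $$ (x, l)))"
        using A[of t] P[of t] il by (simp add: scalar_prod_def atLeast0LessThan A_entry)
      also have "\<dots> = (\<Sum>k\<le>n. ?a k * ?h t ^ k * (\<Sum>x<m. mat_adjoint (P t) $$ (i, x) * (U * (B ^\<^sub>m k * J)) $$ (x, l)))"
        unfolding sum_distrib_left by (subst sum.swap) (simp add: mult_ac)
      also have "\<dots> = (\<Sum>k\<le>n. ?a k * ?h t ^ k * (mat_adjoint (P t) * (U * (B ^\<^sub>m k * J))) $$ (i, l))"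
        using P[of t] U J il by (simp add: scalar_prod_def atLeast0LessThan)
      finally show ?thesis unfolding PU by (simp add: e_def)
    qed
    \<comment> \<open>Row \<open>p + i\<close> and column \<open>l\<close> belong to different
      blocks, where even powers of \<open>B\<close> vanish.\<close>
    moreover have "(B ^\<^sub>m s) $$ (p + i, l) = 0" if "even s" for s
      unfolding B_def using that il by (intro skew_block_parity[OF K]) auto
    ultimately show "(\<lambda>t. (mat_adjoint (P t) * A t) $$ (i, l)) \<in> O[at 0](?g)"
      using exp_pade_entry_bigo[OF B, of "p + i" l n] il m by simp
  qed
  have g0: "(?g \<longlongrightarrow> 0) (at 0)"
    using tendsto_power[OF h0, of "2 * n + 1"] by simp
  \<comment> \<open>\<open>\<Q>\<close> is specified only at full rank, so rank \<open>p\<close> is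
    first deduced from the Gram determinant, which is nonzero for all small
    \<open>t \<noteq> 0\<close>.\<close>
  have "\<exists>R. qr_decomposition (A t) (\<Q> (A t)) R" if "det (mat_adjoint (A t) * A t) \<noteq> 0" for t
    using assms(5)[OF A det_gram_nonzero_imp_rank[OF A that]] .
  then obtain R where R: "\<And>t. det (mat_adjoint (A t) * A t) \<noteq> 0 \<Longrightarrow> qr_decomposition (A t) (\<Q> (A t)) (R t)"
    by metis
  have "\<forall>\<^sub>F t in at 0. det (mat_adjoint (A t) * A t) \<noteq> 0"
    by (rule eventually_det_nonzero[OF _ gram h0])
      (intro always_eventually allI mult_carrier_mat[OF mat_adjoint_carrier[OF A] A])
  hence QR: "\<forall>\<^sub>F t in at 0. \<Q> (A t) \<in> carrier_mat m p \<and> mat_adjoint (\<Q> (A t)) * \<Q> (A t) = 1\<^sub>m p \<and>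
      R t \<in> carrier_mat p p \<and> upper_triangular (R t) \<and> A t = \<Q> (A t) * R t"
  proof eventually_elim
    case (elim t)
    from R[OF elim] A[of t] show ?case
      by (auto simp: qr_decomposition_def orthonormal_cols_def)
  qed
  have "(\<lambda>t. grassmann_dist (\<Q> (A t)) (E t)) \<in> O[at 0](\<lambda>t. cmod (?g t))"
    \<comment> \<open>Two rates enter: \<open>t\<close> for the Gram matrix of \<open>A\<close> and
      \<open>t ^ (2 * n + 1)\<close> for the orthogonal part. Only the second one survives in the
      bound.\<close>
    by (rule grassmann_dist_bigo[OF QR _ gram h0 PA g0]) (use E P EP in simp)
  also have "(\<lambda>t. cmod (?g t)) \<in> O[at 0](\<lambda>t. t ^ (2 * n + 1))"
    by (intro bigoI[of _ 1]) (simp add: norm_mult norm_power abs_mult power_abs)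
  finally show ?thesis by (simp add: A_def E_def exp_eq)
qed

end
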